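(* Let $\Gamma$ be a discrete countable ICC inner-amenable non-amenable group. Then $\Gamma$ does not satisfy the (AO)-property.
   Context: $\Gamma$ is ICC if it is infinite and every conjugacy class other than that of the identity $e$ is infinite. $\Delta_\beta\Gamma$ denotes the Stone-Čech compactification of the discrete space $\Gamma$. $\Gamma$ is inner-amenable if there is a probability measure on $\Delta_\beta\Gamma \setminus \{e\}$ that is invariant for the adjoint action of $\Gamma$, i.e. the extension to $\Delta_\beta \Gamma$ of $\mathrm{ad}(\gamma): x \mapsto \gamma x \gamma^{-1}$, $x,\gamma \in \Gamma$. $\Gamma$ satisfies the (AO)-property if the left-right representation in the Calkin algebra, $\lambda\times\rho : C^*(\Gamma\times\Gamma) \to \mathbb{B}(\ell^2\Gamma)/\mathbb{K}(\ell^2\Gamma)$, is tempered. Here $\lambda\times\rho$ is the composition of the $*$-homomorphism $C^*(\Gamma \times \Gamma) \to \mathbb{B}(\ell^2 \Gamma)$ determined by $(\gamma,\eta)\mapsto \lambda_\gamma\rho_\eta$ ($\lambda$, $\rho$ being the left and right regular representations) with the quotient map by the compact operators $\mathbb{K}(\ell^2\Gamma)$, and tempered means that it factors through the canonical surjection $C^*(\Gamma\times\Gamma)\to C^*_\lambda(\Gamma\times\Gamma)$ from the full group $C^*$-algebra onto the reduced group $C^*$-algebra. *)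

theory Defs
  imports
    "HOL-Probability.Probability"
    "HOL-Algebra.QuotRing"
    "HOL-Algebra.Module"
    "HOL-Library.Poly_Mapping"
begin

text \<open>
  A discrete group is a type of class \<open>group_add\<close>, the library's class of not necessarily
  commutative groups; the group law is written additively, with neutral element \<open>0\<close>.
  The class is closed under products, and \<open>'g \<Rightarrow>\<^sub>0 complex\<close> with its library ring structure
  is the complex group algebra (multiplication is convolution).
\<close>

section \<open>ICC, amenability, inner amenability\<close>

definition icc :: "'g::group_add itself \<Rightarrow> bool" where
  "icc _ \<longleftrightarrow> infinite (UNIV :: 'g set) \<and>
     (\<forall>x::'g. x \<noteq> 0 \<longrightarrow> infinite (range (\<lambda>g. g + x - g)))"

definition amenable :: "'g::group_add itself \<Rightarrow> bool" where
  "amenable _ \<longleftrightarrow> (\<exists>m :: 'g set \<Rightarrow> real.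
     (\<forall>A. 0 \<le> m A) \<and> m UNIV = 1 \<and>
     (\<forall>A B. A \<inter> B = {} \<longrightarrow> m (A \<union> B) = m A + m B) \<and>
     (\<forall>g A. m ((+) g ` A) = m A))"

text \<open>
  The Stone-Cech compactification of a discrete space is the space of its ultrafilters, with
  the closures of the subsets as a basis of open sets. A point \<open>x\<close> is identified with
  \<open>principal {x}\<close>, and the continuous extension of a self-map \<open>f\<close> is \<open>filtermap f\<close>.
\<close>

definition stone_cech :: "'a filter set" where
  "stone_cech = {F. F \<noteq> bot \<and> (\<forall>A. eventually (\<lambda>x. x \<in> A) F \<or> eventually (\<lambda>x. x \<notin> A) F)}"

definition stone_cech_topology :: "'a filter topology" where
  "stone_cech_topology =
     topology_generated_by (range (\<lambda>A. {F \<in> stone_cech. eventually (\<lambda>x. x \<in> A) F}))"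

definition borel_sigma :: "'a topology \<Rightarrow> 'a measure" where
  "borel_sigma X = sigma (topspace X) {U. openin X U}"

text \<open>The measure is an arbitrary Borel probability measure; regularity is not required.\<close>

definition inner_amenable :: "'g::group_add itself \<Rightarrow> bool" where
  "inner_amenable _ \<longleftrightarrow> (\<exists>M :: 'g filter measure.
     prob_space M \<and>
     sets M = sets (borel_sigma (subtopology stone_cech_topology (stone_cech - {principal {0}}))) \<and>
     (\<forall>g. distr M M (filtermap (\<lambda>x. g + x - g)) = M))"


section \<open>The Hilbert space of square-summable functions\<close>

lemma summable_on_mult_l2:
  fixes f h :: "'a \<Rightarrow> complex"
  assumes "(\<lambda>x. (cmod (f x))\<^sup>2) summable_on UNIV" "(\<lambda>x. (cmod (h x))\<^sup>2) summable_on UNIV"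
  shows "(\<lambda>x. norm (cnj (f x) * h x)) summable_on UNIV"
proof (rule Infinite_Sum.abs_summable_on_comparison_test')
  show "(\<lambda>x. (cmod (f x))\<^sup>2 + (cmod (h x))\<^sup>2) summable_on UNIV"
    using assms by (rule summable_on_add)
  show "norm (cnj (f x) * h x) \<le> (cmod (f x))\<^sup>2 + (cmod (h x))\<^sup>2" for x
    using sum_squares_bound[of "cmod (f x)" "cmod (h x)"]
      mult_nonneg_nonneg[OF norm_ge_zero norm_ge_zero, of "f x" "h x"]
    unfolding norm_mult complex_mod_cnj by linarith
qed

typedef 'a ell2 = "{f :: 'a \<Rightarrow> complex. (\<lambda>x. (cmod (f x))\<^sup>2) summable_on UNIV}"
  morphisms ell2_apply Abs_ell2
  by (rule exI[of _ "\<lambda>_. 0"]) simp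

setup_lifting type_definition_ell2

lemma ell2_summable: "(\<lambda>x. (cmod (ell2_apply f x))\<^sup>2) summable_on UNIV"
  using ell2_apply[of f] by simp

lemma ell2_summable_mult: "(\<lambda>x. cnj (ell2_apply f x) * ell2_apply h x) summable_on UNIV"
  by (rule abs_summable_summable, rule summable_on_mult_l2) (rule ell2_summable)+

instantiation ell2 :: (type) real_inner
begin

lift_definition zero_ell2 :: "'a ell2" is "\<lambda>_. 0" by simp

lift_definition plus_ell2 :: "'a ell2 \<Rightarrow> 'a ell2 \<Rightarrow> 'a ell2" is "\<lambda>f h x. f x + h x"
proof -
  fix f h :: "'a \<Rightarrow> complex"
  assume a: "(\<lambda>x. (cmod (f x))\<^sup>2) summable_on UNIV" "(\<lambda>x. (cmod (h x))\<^sup>2) summable_on UNIV"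
  have "(\<lambda>x. 2 * (cmod (f x))\<^sup>2 + 2 * (cmod (h x))\<^sup>2) summable_on UNIV"
    using a by (intro summable_on_add summable_on_cmult_right)
  moreover have "(cmod (f x + h x))\<^sup>2 \<le> 2 * (cmod (f x))\<^sup>2 + 2 * (cmod (h x))\<^sup>2" for x
  proof -
    have "(cmod (f x + h x))\<^sup>2 \<le> (cmod (f x) + cmod (h x))\<^sup>2"
      by (intro power_mono norm_triangle_ineq) simp
    also have "\<dots> \<le> 2 * (cmod (f x))\<^sup>2 + 2 * (cmod (h x))\<^sup>2"
      using sum_squares_bound[of "cmod (f x)" "cmod (h x)"] by (simp add: power2_sum)
    finally show ?thesis .
  qed
  ultimately show "(\<lambda>x. (cmod (f x + h x))\<^sup>2) summable_on UNIV"
    by (rule summable_on_comparison_test) auto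
qed

lift_definition uminus_ell2 :: "'a ell2 \<Rightarrow> 'a ell2" is "\<lambda>f x. - f x" by simp

definition minus_ell2 :: "'a ell2 \<Rightarrow> 'a ell2 \<Rightarrow> 'a ell2" where
  "minus_ell2 f h = f + - h"

lift_definition scaleR_ell2 :: "real \<Rightarrow> 'a ell2 \<Rightarrow> 'a ell2" is "\<lambda>r f x. r *\<^sub>R f x"
  by (simp add: power_mult_distrib summable_on_cmult_right)

definition inner_ell2 :: "'a ell2 \<Rightarrow> 'a ell2 \<Rightarrow> real" where
  "inner_ell2 f h = Re (\<Sum>\<^sub>\<infinity>x. cnj (ell2_apply f x) * ell2_apply h x)"

definition norm_ell2 :: "'a ell2 \<Rightarrow> real" where
  "norm_ell2 f = sqrt (inner f f)"

definition sgn_ell2 :: "'a ell2 \<Rightarrow> 'a ell2" where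
  "sgn_ell2 f = scaleR (inverse (norm f)) f"

definition dist_ell2 :: "'a ell2 \<Rightarrow> 'a ell2 \<Rightarrow> real" where
  "dist_ell2 f h = norm (f - h)"

definition uniformity_ell2 :: "('a ell2 \<times> 'a ell2) filter" where
  "uniformity_ell2 = (INF e\<in>{0<..}. principal {(x, y). dist x y < e})"

definition open_ell2 :: "'a ell2 set \<Rightarrow> bool" where
  "open_ell2 U = (\<forall>x\<in>U. eventually (\<lambda>(x', y). x' = x \<longrightarrow> y \<in> U) uniformity)"

lemma inner_ell2_self:
  "inner f f = (\<Sum>\<^sub>\<infinity>x. (cmod (ell2_apply f x))\<^sup>2)" for f :: "'a ell2"
proof -
  have "Re (cnj (ell2_apply f x) * ell2_apply f x) = (cmod (ell2_apply f x))\<^sup>2" for x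
    by (simp add: cmod_power2 flip: power2_eq_square)
  then show ?thesis
    unfolding inner_ell2_def infsum_Re[OF ell2_summable_mult, symmetric] by simp
qed

instance
proof
  fix x y z :: "'a ell2" and a b :: real
  show "x + y + z = x + (y + z)" by transfer (simp add: add.assoc)
  show "x + y = y + x" by transfer (simp add: add.commute)
  show "0 + x = x" by transfer simp
  show "- x + x = 0" by transfer simp
  show "x - y = x + - y" by (rule minus_ell2_def)
  show "a *\<^sub>R (x + y) = a *\<^sub>R x + a *\<^sub>R y" by transfer (simp add: scaleR_add_right)
  show "(a + b) *\<^sub>R x = a *\<^sub>R x + b *\<^sub>R x" by transfer (simp add: scaleR_add_left)
  show "a *\<^sub>R b *\<^sub>R x = (a * b) *\<^sub>R x" by transfer simp
  show "1 *\<^sub>R x = x" by transfer simp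
  show "sgn x = scaleR (inverse (norm x)) x" by (rule sgn_ell2_def)
  show "dist x y = norm (x - y)" by (rule dist_ell2_def)
  show "(uniformity :: ('a ell2 \<times> 'a ell2) filter)
      = (INF e\<in>{0<..}. principal {(x, y). dist x y < e})" by (rule uniformity_ell2_def)
  show "open U = (\<forall>x\<in>U. eventually (\<lambda>(x', y). x' = x \<longrightarrow> y \<in> U) uniformity)"
    for U :: "'a ell2 set" by (rule open_ell2_def)
  show "inner x y = inner y x"
    unfolding inner_ell2_def infsum_Re[OF ell2_summable_mult, symmetric]
    by (simp add: mult.commute)
  show "inner (x + y) z = inner x z + inner y z"
    unfolding inner_ell2_def
    by (simp add: plus_ell2.rep_eq distrib_right infsum_add ell2_summable_mult)
  show "inner (a *\<^sub>R x) y = a * inner x y"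
    unfolding inner_ell2_def
    by (simp add: scaleR_ell2.rep_eq infsum_scaleR_right)
  show "0 \<le> inner x x"
    unfolding inner_ell2_self by (intro infsum_nonneg) simp
  show "inner x x = 0 \<longleftrightarrow> x = 0"
  proof
    assume "inner x x = 0"
    then have "(cmod (ell2_apply x t))\<^sup>2 = 0" for t
      unfolding inner_ell2_self
      by (intro nonneg_infsum_le_0D[of "\<lambda>t. (cmod (ell2_apply x t))\<^sup>2" UNIV t] ell2_summable) auto
    then show "x = 0" by transfer auto
  next
    assume "x = 0"
    then show "inner x x = 0" by (simp add: inner_ell2_self zero_ell2.rep_eq)
  qed
  show "norm x = sqrt (inner x x)" by (rule norm_ell2_def)
qed

end

lemma norm_ell2_eq: "norm f = sqrt (\<Sum>\<^sub>\<infinity>x. (cmod (ell2_apply f x))\<^sup>2)"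
  by (simp add: norm_eq_sqrt_inner inner_ell2_self)

definition cinner :: "'a ell2 \<Rightarrow> 'a ell2 \<Rightarrow> complex" where
  "cinner f h = (\<Sum>\<^sub>\<infinity>x. cnj (ell2_apply f x) * ell2_apply h x)"

lift_definition cscale_ell2 :: "complex \<Rightarrow> 'a ell2 \<Rightarrow> 'a ell2" is "\<lambda>c f x. c * f x"
  by (simp add: norm_mult power_mult_distrib summable_on_cmult_right)

lift_definition cscale :: "complex \<Rightarrow> 'a ell2 \<Rightarrow>\<^sub>L 'a ell2" is cscale_ell2
proof
  fix c r and f h :: "'a ell2"
  show "cscale_ell2 c (f + h) = cscale_ell2 c f + cscale_ell2 c h"
    by transfer (simp add: distrib_left)
  show "cscale_ell2 c (r *\<^sub>R f) = r *\<^sub>R cscale_ell2 c f"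
    by transfer simp
  have "norm (cscale_ell2 c f) = norm f * cmod c" for f :: "'a ell2"
    by (simp add: norm_ell2_eq cscale_ell2.rep_eq norm_mult power_mult_distrib
        infsum_cmult_right' real_sqrt_mult)
  then show "\<exists>K. \<forall>f :: 'a ell2. norm (cscale_ell2 c f) \<le> norm f * K"
    by (metis order_refl)
qed

lemma bounded_linear_pullback:
  fixes T :: "'a ell2 \<Rightarrow> 'a ell2"
  assumes s: "bij s" and T: "\<And>f x. ell2_apply (T f) x = ell2_apply f (s x)"
  shows "bounded_linear T"
proof
  fix f h :: "'a ell2" and r
  show "T (f + h) = T f + T h" "T (r *\<^sub>R f) = r *\<^sub>R T f"
    by (simp_all flip: ell2_apply_inject add: fun_eq_iff T plus_ell2.rep_eq scaleR_ell2.rep_eq)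
  have "norm (T f) \<le> norm f * 1" for f
    unfolding norm_ell2_eq T
    using infsum_reindex_bij_betw[of s UNIV UNIV "\<lambda>x. (cmod (ell2_apply f x))\<^sup>2"] s by simp
  then show "\<exists>K. \<forall>f. norm (T f) \<le> norm f * K" by blast
qed

lemma ell2_pullback:
  assumes "(\<lambda>x. (cmod (f x))\<^sup>2) summable_on UNIV" "bij s"
  shows "(\<lambda>x. (cmod (f (s x)))\<^sup>2) summable_on UNIV"
  using summable_on_reindex_bij_betw[of s UNIV UNIV "\<lambda>x. (cmod (f x))\<^sup>2"] assms by simp

lemma bij_left_translation: "bij (\<lambda>x::'g::group_add. - g + x)"
  by (rule bij_betwI[of _ _ _ "\<lambda>x. g + x"]) (auto simp flip: add.assoc)

lemma bij_right_translation: "bij (\<lambda>x::'g::group_add. x + g)"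
  by (rule bij_betwI[of _ _ _ "\<lambda>x. x - g"]) auto

lift_definition left_shift :: "'g::group_add \<Rightarrow> 'g ell2 \<Rightarrow> 'g ell2" is "\<lambda>g f x. f (- g + x)"
  by (rule ell2_pullback[OF _ bij_left_translation])

lift_definition right_shift :: "'g::group_add \<Rightarrow> 'g ell2 \<Rightarrow> 'g ell2" is "\<lambda>g f x. f (x + g)"
  by (rule ell2_pullback[OF _ bij_right_translation])

text \<open>The unitaries of the left and of the right regular representation.\<close>

lift_definition lambda_op :: "'g::group_add \<Rightarrow> 'g ell2 \<Rightarrow>\<^sub>L 'g ell2" is left_shift
  by (rule bounded_linear_pullback[OF bij_left_translation fun_cong[OF left_shift.rep_eq]])

lift_definition rho_op :: "'g::group_add \<Rightarrow> 'g ell2 \<Rightarrow>\<^sub>L 'g ell2" is right_shift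
  by (rule bounded_linear_pullback[OF bij_right_translation fun_cong[OF right_shift.rep_eq]])


section \<open>Star-algebras, bounded operators, the Calkin algebra\<close>

record 'a star_algebra = "(complex, 'a) module" +
  adj :: "'a \<Rightarrow> 'a"

definition star_hom :: "'a star_algebra \<Rightarrow> 'b star_algebra \<Rightarrow> ('a \<Rightarrow> 'b) set" where
  "star_hom A B = {\<phi> \<in> ring_hom A B.
     (\<forall>c. \<forall>x\<in>carrier A. \<phi> (c \<odot>\<^bsub>A\<^esub> x) = c \<odot>\<^bsub>B\<^esub> \<phi> x) \<and>
     (\<forall>x\<in>carrier A. \<phi> (adj A x) = adj B (\<phi> x))}"

text \<open>The scalar multiplication and the involution of cosets follow the pattern of
  \<^const>\<open>rcoset_mult\<close>.\<close>

definition star_quot :: "'a star_algebra \<Rightarrow> 'a set \<Rightarrow> 'a set star_algebra" where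
  "star_quot A I =
     \<lparr>carrier = carrier (A Quot I), mult = mult (A Quot I), one = one (A Quot I),
      zero = zero (A Quot I), add = add (A Quot I),
      smult = (\<lambda>c X. \<Union>x\<in>X. I +>\<^bsub>A\<^esub> (c \<odot>\<^bsub>A\<^esub> x)),
      adj = (\<lambda>X. \<Union>x\<in>X. I +>\<^bsub>A\<^esub> adj A x)\<rparr>"

text \<open>\<open>'a ell2 \<Rightarrow>\<^sub>L 'a ell2\<close> consists of the real-linear bounded operators; the
  carrier below singles out the complex-linear ones.\<close>

definition complex_linear_ops :: "('a ell2 \<Rightarrow>\<^sub>L 'a ell2) set" where
  "complex_linear_ops = {T. \<forall>c. T o\<^sub>L cscale c = cscale c o\<^sub>L T}"

definition hilbert_adjoint :: "('a ell2 \<Rightarrow>\<^sub>L 'a ell2) \<Rightarrow> 'a ell2 \<Rightarrow>\<^sub>L 'a ell2" where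
  "hilbert_adjoint T = (THE S. \<forall>f h. cinner (blinfun_apply S f) h = cinner f (blinfun_apply T h))"

definition bounded_ops :: "('a ell2 \<Rightarrow>\<^sub>L 'a ell2) star_algebra" where
  "bounded_ops =
     \<lparr>carrier = complex_linear_ops, mult = (o\<^sub>L), one = id_blinfun, zero = 0, add = (+),
      smult = (\<lambda>c T. cscale c o\<^sub>L T), adj = hilbert_adjoint\<rparr>"

definition compact_ops :: "('a ell2 \<Rightarrow>\<^sub>L 'a ell2) set" where
  "compact_ops = {T \<in> complex_linear_ops. compact (closure (blinfun_apply T ` cball 0 1))}"

definition calkin :: "('a ell2 \<Rightarrow>\<^sub>L 'a ell2) set star_algebra" where
  "calkin = star_quot bounded_ops compact_ops"

definition calkin_proj :: "('a ell2 \<Rightarrow>\<^sub>L 'a ell2) \<Rightarrow> ('a ell2 \<Rightarrow>\<^sub>L 'a ell2) set" where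
  "calkin_proj T = compact_ops +>\<^bsub>bounded_ops\<^esub> T"


section \<open>Group C*-algebras\<close>

definition galg_scale :: "complex \<Rightarrow> ('g \<Rightarrow>\<^sub>0 complex) \<Rightarrow> 'g \<Rightarrow>\<^sub>0 complex" where
  "galg_scale c a = Poly_Mapping.map ((*) c) a"

definition galg_adj :: "('g::group_add \<Rightarrow>\<^sub>0 complex) \<Rightarrow> 'g \<Rightarrow>\<^sub>0 complex" where
  "galg_adj a = (\<Sum>g\<in>Poly_Mapping.keys a. Poly_Mapping.single (- g) (cnj (Poly_Mapping.lookup a g)))"

definition cstar_seminorm :: "(('g::group_add \<Rightarrow>\<^sub>0 complex) \<Rightarrow> real) \<Rightarrow> bool" where
  "cstar_seminorm p \<longleftrightarrow>
     (\<forall>a. 0 \<le> p a) \<and>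
     (\<forall>a b. p (a + b) \<le> p a + p b) \<and>
     (\<forall>c a. p (galg_scale c a) = cmod c * p a) \<and>
     (\<forall>a b. p (a * b) \<le> p a * p b) \<and>
     (\<forall>a. p (galg_adj a * a) = (p a)\<^sup>2)"

text \<open>
  The norm of the full group C*-algebra is the largest C*-seminorm on the group algebra, i.e.
  the supremum of the operator norms over all unitary representations. Taking the supremum over
  C*-seminorms avoids a quantification over all Hilbert spaces. The set is bounded by
  \<open>full_norm_bound\<close> below.
\<close>

definition full_norm :: "('g::group_add \<Rightarrow>\<^sub>0 complex) \<Rightarrow> real" where
  "full_norm a = (SUP p\<in>Collect cstar_seminorm. p a)"

lemma full_norm_bound:
  fixes a :: "'g::group_add \<Rightarrow>\<^sub>0 complex"
  assumes "cstar_seminorm p"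
  shows "p a \<le> (\<Sum>g\<in>Poly_Mapping.keys a. cmod (Poly_Mapping.lookup a g))"
proof -
  have nn: "0 \<le> p x" and add: "p (x + y) \<le> p x + p y"
    and sc: "p (galg_scale c x) = cmod c * p x" and mult: "p (x * y) \<le> p x * p y"
    and cs: "p (galg_adj x * x) = (p x)\<^sup>2" for x y c
    using assms unfolding cstar_seminorm_def by blast+
  have scale_single: "galg_scale c (Poly_Mapping.single g d) = Poly_Mapping.single g (c * d)"
    for c d and g :: 'g
    by (rule poly_mapping_eqI)
      (simp add: galg_scale_def Poly_Mapping.map.rep_eq lookup_single when_def)
  have zero: "p 0 = 0"
    using sc[of 0 0] scale_single[of 0 0 0] by simp
  have one: "p 1 \<le> 1"
    using cs[of 1] by (auto simp: galg_adj_def power2_eq_square)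
  have unit: "p (Poly_Mapping.single g 1) \<le> 1" for g :: 'g
  proof -
    have "(p (Poly_Mapping.single g 1))\<^sup>2 = p 1"
      using cs[of "Poly_Mapping.single g 1"] by (simp add: galg_adj_def mult_single)
    then have "(p (Poly_Mapping.single g 1))\<^sup>2 \<le> 1" using one by simp
    then show ?thesis using power2_le_imp_le[of _ "1::real"] by simp
  qed
  have sum: "p (sum f S) \<le> (\<Sum>x\<in>S. p (f x))" if "finite S" for f :: "'g \<Rightarrow> _" and S
    using that by induction (auto simp: zero intro: order_trans[OF add])
  have "p a = p (\<Sum>g\<in>Poly_Mapping.keys a. Poly_Mapping.single g (Poly_Mapping.lookup a g))"
    by (intro arg_cong[of _ _ p] poly_mapping_eqI)
      (simp add: lookup_sum lookup_single when_def in_keys_iff)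
  also have "\<dots> \<le> (\<Sum>g\<in>Poly_Mapping.keys a. p (Poly_Mapping.single g (Poly_Mapping.lookup a g)))"
    by (rule sum) simp
  also have "\<dots> \<le> (\<Sum>g\<in>Poly_Mapping.keys a. cmod (Poly_Mapping.lookup a g))"
  proof (rule sum_mono)
    fix g
    show "p (Poly_Mapping.single g (Poly_Mapping.lookup a g)) \<le> cmod (Poly_Mapping.lookup a g)"
      using sc[of "Poly_Mapping.lookup a g" "Poly_Mapping.single g 1"] unit[of g]
      by (simp add: scale_single mult_left_le)
  qed
  finally show ?thesis .
qed

text \<open>The full group C*-algebra is the completion of the group algebra with respect to
  \<^const>\<open>full_norm\<close>: Cauchy sequences modulo null sequences.\<close>

definition cauchy_seqs :: "(nat \<Rightarrow> ('g::group_add \<Rightarrow>\<^sub>0 complex)) star_algebra" where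
  "cauchy_seqs =
     \<lparr>carrier = {s. \<forall>e>0. \<exists>N. \<forall>m\<ge>N. \<forall>n\<ge>N. full_norm (s m - s n) < e},
      mult = (\<lambda>s t n. s n * t n), one = (\<lambda>n. 1), zero = (\<lambda>n. 0), add = (\<lambda>s t n. s n + t n),
      smult = (\<lambda>c s n. galg_scale c (s n)), adj = (\<lambda>s n. galg_adj (s n))\<rparr>"

definition null_seqs :: "(nat \<Rightarrow> ('g::group_add \<Rightarrow>\<^sub>0 complex)) set" where
  "null_seqs = {s. (\<lambda>n. full_norm (s n)) \<longlonglongrightarrow> 0}"

definition full_cstar :: "(nat \<Rightarrow> ('g::group_add \<Rightarrow>\<^sub>0 complex)) set star_algebra" where
  "full_cstar = star_quot cauchy_seqs null_seqs"

text \<open>The extension by continuity to the full group C*-algebra of a representation of the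
  group algebra by bounded operators.\<close>

definition full_extend ::
    "(('g::group_add \<Rightarrow>\<^sub>0 complex) \<Rightarrow> 'a ell2 \<Rightarrow>\<^sub>L 'a ell2) \<Rightarrow>
     (nat \<Rightarrow> ('g \<Rightarrow>\<^sub>0 complex)) set \<Rightarrow> 'a ell2 \<Rightarrow>\<^sub>L 'a ell2" where
  "full_extend \<pi> X = (THE T. \<forall>s\<in>X. (\<lambda>n. \<pi> (s n)) \<longlonglongrightarrow> T)"

definition regular_rep :: "('g::group_add \<Rightarrow>\<^sub>0 complex) \<Rightarrow> 'g ell2 \<Rightarrow>\<^sub>L 'g ell2" where
  "regular_rep a = (\<Sum>g\<in>Poly_Mapping.keys a. cscale (Poly_Mapping.lookup a g) o\<^sub>L lambda_op g)"

definition reduced_cstar :: "('g::group_add ell2 \<Rightarrow>\<^sub>L 'g ell2) star_algebra" where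
  "reduced_cstar = bounded_ops\<lparr>carrier := closure (range regular_rep)\<rparr>"

definition canonical_surj ::
    "(nat \<Rightarrow> ('g::group_add \<Rightarrow>\<^sub>0 complex)) set \<Rightarrow> 'g ell2 \<Rightarrow>\<^sub>L 'g ell2" where
  "canonical_surj = full_extend regular_rep"


section \<open>The (AO)-property\<close>

definition left_right_rep :: "('g::group_add \<times> 'g \<Rightarrow>\<^sub>0 complex) \<Rightarrow> 'g ell2 \<Rightarrow>\<^sub>L 'g ell2" where
  "left_right_rep a =
     (\<Sum>(g, h)\<in>Poly_Mapping.keys a. cscale (Poly_Mapping.lookup a (g, h)) o\<^sub>L (lambda_op g o\<^sub>L rho_op h))"

definition left_right_calkin ::
    "(nat \<Rightarrow> ('g::group_add \<times> 'g \<Rightarrow>\<^sub>0 complex)) set \<Rightarrow> ('g ell2 \<Rightarrow>\<^sub>L 'g ell2) set" where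
  "left_right_calkin X = calkin_proj (full_extend left_right_rep X)"

definition AO_property :: "'g::group_add itself \<Rightarrow> bool" where
  "AO_property _ \<longleftrightarrow>
     (\<exists>\<phi> \<in> star_hom (reduced_cstar :: (('g \<times> 'g) ell2 \<Rightarrow>\<^sub>L ('g \<times> 'g) ell2) star_algebra)
                     (calkin :: ('g ell2 \<Rightarrow>\<^sub>L 'g ell2) set star_algebra).
        \<forall>X \<in> carrier full_cstar. \<phi> (canonical_surj X) = left_right_calkin X)"

end

theory Submission
  imports Defs
begin

text \<open>
  Suppose that \<open>\<Gamma>\<close> has the (AO)-property. Non-amenability yields a finite symmetric set \<open>F\<close> containing
  the neutral element such that the average \<open>a\<close> of the \<open>\<lambda>(g, g)\<close>, \<open>g \<in> F\<close>, has norm less than 1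
  on the square-summable functions on \<open>\<Gamma> \<times> \<Gamma>\<close>. Then \<open>1 - a\<close> is invertible in the reduced C*-algebra
  (Neumann series), so the (AO)-property makes \<open>1 - T\<close> left invertible modulo the compact operators,
  where \<open>T\<close> is the average of the operators \<open>\<lambda>(g) \<rho>(g)\<close>. A compact operator is small on vectors supported
  off a large finite set \<open>E\<close>; hence, by uniform convexity, \<open>T\<close> contracts these vectors by a factor
  less than 1.

  A Neumann series for the compression of \<open>T\<close>, applied to a strictly positive vector, gives a
  function \<open>W\<close> that is zero on \<open>E\<close>, positive off \<open>E\<close>, and whose average over the conjugates of
  \<open>x\<close> by \<open>F\<close> is at most \<open>q W(x)\<close> with \<open>q < 1\<close>. So the average over \<open>g \<in> F\<close> of the bounded functions
  \<open>r(g, x) = W(- g + x + g) / W(x)\<close> is at most \<open>q\<close>. But \<open>r(g, x)\<close> and \<open>r(- g, - g + x + g)\<close> are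
  inverse to each other off a finite set, which is negligible by the ICC assumption. For a
  conjugation invariant mean the means of \<open>r(g, _)\<close> and \<open>r(- g, _)\<close> therefore add up to at least 2,
  and the mean of the average is at least 1.
\<close>

section \<open>Square-summable functions\<close>

lemma ell2_eqI: "(\<And>x. ell2_apply f x = ell2_apply h x) \<Longrightarrow> f = h"
  by (simp flip: ell2_apply_inject add: fun_eq_iff)

lemmas ell2_apply_simps [simp] =
  zero_ell2.rep_eq plus_ell2.rep_eq uminus_ell2.rep_eq scaleR_ell2.rep_eq cscale_ell2.rep_eq
  left_shift.rep_eq right_shift.rep_eq cscale.rep_eq lambda_op.rep_eq rho_op.rep_eq

lemma ell2_apply_diff [simp]: "ell2_apply (f - h) x = ell2_apply f x - ell2_apply h x"
  unfolding minus_ell2_def plus_ell2.rep_eq uminus_ell2.rep_eq by simp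

lemma ell2_apply_sum [simp]: "ell2_apply (\<Sum>i\<in>I. f i) x = (\<Sum>i\<in>I. ell2_apply (f i) x)"
  by (induction I rule: infinite_finite_induct) auto

lemma norm_ell2_power2: "(norm f)\<^sup>2 = (\<Sum>\<^sub>\<infinity>x. (cmod (ell2_apply f x))\<^sup>2)"
  by (simp add: power2_norm_eq_inner inner_ell2_self)

lemma sum_le_norm_ell2: "finite F \<Longrightarrow> (\<Sum>x\<in>F. (cmod (ell2_apply f x))\<^sup>2) \<le> (norm f)\<^sup>2"
  unfolding norm_ell2_power2 by (rule finite_sum_le_infsum[OF ell2_summable]) auto

lemma norm_ell2_le:
  assumes "0 \<le> C" "\<And>F. finite F \<Longrightarrow> (\<Sum>x\<in>F. (cmod (ell2_apply f x))\<^sup>2) \<le> C\<^sup>2"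
  shows "norm f \<le> C"
proof (rule power2_le_imp_le)
  show "(norm f)\<^sup>2 \<le> C\<^sup>2"
    unfolding norm_ell2_power2
    by (rule infsum_le_finite_sums[OF ell2_summable]) (use assms in auto)
qed (use assms in auto)

lemma cmod_ell2_apply_le: "cmod (ell2_apply f x) \<le> norm f"
  by (rule power2_le_imp_le) (use sum_le_norm_ell2[of "{x}" f] in auto)

lemma bounded_linear_ell2_apply: "bounded_linear (\<lambda>f. ell2_apply f x)"
  by (rule bounded_linear_intro[of _ 1]) (auto simp: cmod_ell2_apply_le)

text \<open>Coordinates of a Cauchy sequence converge, and the Cauchy estimate on a finite set of
  coordinates survives the limit with a bound independent of that set. Completeness is what makes
  the two Neumann series below converge.\<close>

instance ell2 :: (type) complete_space
proof
  fix X :: "nat \<Rightarrow> 'a ell2"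
  assume X: "Cauchy X"
  define g where "g x = lim (\<lambda>n. ell2_apply (X n) x)" for x
  have g: "(\<lambda>n. ell2_apply (X n) x) \<longlonglongrightarrow> g x" for x
    using bounded_linear.Cauchy[OF bounded_linear_ell2_apply X, of x]
    by (simp add: g_def Cauchy_convergent_iff convergent_LIMSEQ_iff)
  have bound: "\<exists>N. \<forall>m\<ge>N. \<forall>F. finite F \<longrightarrow> (\<Sum>x\<in>F. (cmod (ell2_apply (X m) x - g x))\<^sup>2) \<le> e\<^sup>2"
    if e: "0 < e" for e :: real
  proof -
    obtain N where N: "\<And>m n. N \<le> m \<Longrightarrow> N \<le> n \<Longrightarrow> norm (X m - X n) < e"
      using X e unfolding Cauchy_iff by blast
    have "(\<Sum>x\<in>F. (cmod (ell2_apply (X m) x - g x))\<^sup>2) \<le> e\<^sup>2" if "N \<le> m" "finite F" for m F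
    proof (rule LIMSEQ_le_const2)
      show "(\<lambda>n. \<Sum>x\<in>F. (cmod (ell2_apply (X m) x - ell2_apply (X n) x))\<^sup>2)
          \<longlonglongrightarrow> (\<Sum>x\<in>F. (cmod (ell2_apply (X m) x - g x))\<^sup>2)"
        by (intro tendsto_intros g)
      have "(\<Sum>x\<in>F. (cmod (ell2_apply (X m) x - ell2_apply (X n) x))\<^sup>2) \<le> e\<^sup>2" if "N \<le> n" for n
      proof -
        have "(\<Sum>x\<in>F. (cmod (ell2_apply (X m - X n) x))\<^sup>2) \<le> (norm (X m - X n))\<^sup>2"
          by (rule sum_le_norm_ell2) fact
        also have "\<dots> \<le> e\<^sup>2"
          using N[OF \<open>N \<le> m\<close> that] by (intro power_mono) auto
        finally show ?thesis by simp
      qed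
      then show "\<exists>N. \<forall>n\<ge>N. (\<Sum>x\<in>F. (cmod (ell2_apply (X m) x - ell2_apply (X n) x))\<^sup>2) \<le> e\<^sup>2"
        by blast
    qed
    then show ?thesis by blast
  qed
  have summ: "(\<lambda>x. (cmod (ell2_apply (X m) x - g x))\<^sup>2) summable_on UNIV"
    if "\<forall>F. finite F \<longrightarrow> (\<Sum>x\<in>F. (cmod (ell2_apply (X m) x - g x))\<^sup>2) \<le> e\<^sup>2" for m e
    by (rule nonneg_bdd_above_summable_on) (use that in \<open>auto intro!: bdd_aboveI2[of _ _ "e\<^sup>2"]\<close>)
  obtain N where "\<forall>F. finite F \<longrightarrow> (\<Sum>x\<in>F. (cmod (ell2_apply (X N) x - g x))\<^sup>2) \<le> 1\<^sup>2"
    using bound[of 1] by auto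
  then have "(\<lambda>x. (cmod (ell2_apply (X N) x - g x))\<^sup>2) summable_on UNIV"
    by (rule summ)
  then have d: "ell2_apply (Abs_ell2 (\<lambda>x. ell2_apply (X N) x - g x)) x = ell2_apply (X N) x - g x" for x
    by (subst Abs_ell2_inverse) auto
  \<comment> \<open>Only the differences from the pointwise limit \<open>g\<close> have been shown
    to be square-summable, so \<open>g\<close> is recovered from one of them.\<close>
  define G where "G = X N - Abs_ell2 (\<lambda>x. ell2_apply (X N) x - g x)"
  have G: "ell2_apply G x = g x" for x
    by (simp add: G_def d)
  have "X \<longlonglongrightarrow> G"
  proof (rule LIMSEQ_I)
    fix r :: real
    assume "0 < r"
    then obtain N where N: "\<And>m F. N \<le> m \<Longrightarrow> finite F \<Longrightarrow>
        (\<Sum>x\<in>F. (cmod (ell2_apply (X m) x - g x))\<^sup>2) \<le> (r / 2)\<^sup>2"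
      using bound[of "r / 2"] by auto
    have "norm (X m - G) \<le> r / 2" if "N \<le> m" for m
      using N[OF that] \<open>0 < r\<close> by (intro norm_ell2_le) (auto simp: G)
    then show "\<exists>no. \<forall>n\<ge>no. norm (X n - G) < r"
      using \<open>0 < r\<close> by (intro exI[of _ N]) (smt (verit) field_sum_of_halves)
  qed
  then show "convergent X"
    by (rule convergentI)
qed

instance ell2 :: (type) banach ..

text \<open>The coordinate projection onto functions supported in \<open>A\<close>. Throughout,
  \<open>restr E f = 0\<close> expresses that \<open>f\<close> is supported off
  \<open>E\<close>.\<close>

lift_definition restr :: "'a set \<Rightarrow> 'a ell2 \<Rightarrow> 'a ell2" is "\<lambda>A f x. if x \<in> A then f x else 0"
  by (rule summable_on_comparison_test) auto

lemmas restr_apply [simp] = restr.rep_eq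

lemma restr_diff: "restr A (f - h) = restr A f - restr A h"
  by (rule ell2_eqI) simp

lemma norm_restr_power2:
  "(norm (restr A f))\<^sup>2 = (\<Sum>\<^sub>\<infinity>x\<in>A. (cmod (ell2_apply f x))\<^sup>2)"
  unfolding norm_ell2_power2 by (rule infsum_cong_neutral) auto

lemma norm_restr_Un:
  assumes "A \<inter> B = {}"
  shows "(norm (restr (A \<union> B) f))\<^sup>2 = (norm (restr A f))\<^sup>2 + (norm (restr B f))\<^sup>2"
  unfolding norm_restr_power2
  by (intro infsum_Un_disjoint summable_on_subset_banach[OF ell2_summable] assms) auto

lemma restr_UNIV [simp]: "restr UNIV f = f"
  by (rule ell2_eqI) simp

lemma norm_restr_Compl: "(norm f)\<^sup>2 = (norm (restr A f))\<^sup>2 + (norm (restr (- A) f))\<^sup>2"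
  using norm_restr_Un[of A "- A" f] by simp

lemma norm_restr_le: "norm (restr A f) \<le> norm f"
  by (rule power2_le_imp_le) (auto simp: norm_restr_Compl[of f A])

lemma restr_finite_approx:
  assumes "0 < e"
  obtains E where "finite E" "norm (f - restr E f) < e"
proof -
  have "((\<lambda>x. (cmod (ell2_apply f x))\<^sup>2) has_sum (norm f)\<^sup>2) UNIV"
    unfolding norm_ell2_power2 by (rule has_sum_infsum[OF ell2_summable])
  then have "eventually (\<lambda>E. dist (\<Sum>x\<in>E. (cmod (ell2_apply f x))\<^sup>2) ((norm f)\<^sup>2) < e\<^sup>2)
      (finite_subsets_at_top UNIV)"
    unfolding has_sum_def using assms by (intro tendstoD) auto
  then obtain E where E: "finite E" "dist (\<Sum>x\<in>E. (cmod (ell2_apply f x))\<^sup>2) ((norm f)\<^sup>2) < e\<^sup>2"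
    unfolding eventually_finite_subsets_at_top by blast
  have "f - restr E f = restr (- E) f"
    by (rule ell2_eqI) auto
  then have "(norm (f - restr E f))\<^sup>2 = (norm f)\<^sup>2 - (\<Sum>x\<in>E. (cmod (ell2_apply f x))\<^sup>2)"
    using norm_restr_Compl[of f E] norm_restr_power2[of E f] E(1) by simp
  also have "\<dots> < e\<^sup>2"
    using E(2) by (auto simp: dist_real_def abs_less_iff)
  finally show thesis
    using that E(1) assms by (meson less_imp_le power_less_imp_less_base)
qed

lemma inner_ell2_disjoint:
  assumes "\<And>x. ell2_apply f x = 0 \<or> ell2_apply h x = 0"
  shows "inner f h = 0"
proof -
  have "cnj (ell2_apply f x) * ell2_apply h x = 0" for x
    using assms[of x] by auto
  then show ?thesis unfolding inner_ell2_def by (subst infsum_0) auto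
qed

section \<open>Averages of isometries\<close>

text \<open>Uniform convexity of the norm: an average of unit vectors can only be long if the vectors
  are close to each other.\<close>

lemma unit_vectors_close:
  fixes u :: "'i \<Rightarrow> 'a::real_inner"
  assumes "finite F" "i \<in> F" "j \<in> F" "\<And>k. k \<in> F \<Longrightarrow> norm (u k) = 1"
  shows "(norm (u i - u j))\<^sup>2 \<le> 4 * (real (card F) - norm (\<Sum>k\<in>F. u k))"
proof (cases "i = j")
  case True
  have "norm (\<Sum>k\<in>F. u k) \<le> (\<Sum>k\<in>F. norm (u k))" by (rule norm_sum)
  then show ?thesis using True assms(4) by simp
next
  case False
  have F: "F = insert i (insert j (F - {i, j}))" using assms by auto
  \<comment> \<open>The other vectors contribute at most \<open>card F - 2\<close>, so the length
    missing from \<open>u i + u j\<close> is at most the length missing from the whole sum.\<close>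
  have "norm (\<Sum>k\<in>F - {i, j}. u k) \<le> (\<Sum>k\<in>F - {i, j}. norm (u k))" by (rule norm_sum)
  also have "\<dots> = real (card F) - 2"
    using assms False card_mono[of F "{i, j}"] by (simp add: card_Diff_subset of_nat_diff)
  finally have rest: "norm (\<Sum>k\<in>F - {i, j}. u k) \<le> real (card F) - 2" .
  have "(\<Sum>k\<in>F. u k) = (u i + u j) + (\<Sum>k\<in>F - {i, j}. u k)"
    by (subst F) (use False assms(1) in \<open>simp add: add.assoc\<close>)
  then have "norm (\<Sum>k\<in>F. u k) \<le> norm (u i + u j) + (real (card F) - 2)"
    using norm_triangle_ineq[of "u i + u j" "\<Sum>k\<in>F - {i, j}. u k"] rest by simp
  then have A: "2 - norm (u i + u j) \<le> real (card F) - norm (\<Sum>k\<in>F. u k)" by simp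
  have B: "norm (u i + u j) \<le> 2"
    using norm_triangle_ineq[of "u i" "u j"] assms by simp
  \<comment> \<open>The parallelogram law, then a difference of squares.\<close>
  have "(norm (u i - u j))\<^sup>2 = 2 * (norm (u i))\<^sup>2 + 2 * (norm (u j))\<^sup>2 - (norm (u i + u j))\<^sup>2"
    by (simp add: power2_norm_eq_inner inner_simps inner_commute)
  also have "\<dots> = (2 - norm (u i + u j)) * (2 + norm (u i + u j))"
    using assms by (simp add: algebra_simps power2_eq_square)
  also have "\<dots> \<le> (2 - norm (u i + u j)) * 4"
    using B by (intro mult_left_mono) auto
  also have "\<dots> \<le> 4 * (real (card F) - norm (\<Sum>k\<in>F. u k))"
    using A by simp
  finally show ?thesis .
qed

section \<open>Unitary representations of the group algebra\<close>

lemma cscale_add: "cscale (c + d) = cscale c + cscale d"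
  by (auto intro!: blinfun_eqI ell2_eqI simp: blinfun.add_left distrib_right)

lemma cscale_mult: "cscale (c * d) = cscale c o\<^sub>L cscale d"
  by (auto intro!: blinfun_eqI ell2_eqI)

lemma cscale_one [simp]: "cscale 1 = id_blinfun"
  by (auto intro!: blinfun_eqI ell2_eqI)

lemma cscale_zero [simp]: "cscale 0 = 0"
  by (auto intro!: blinfun_eqI ell2_eqI)

lemma id_compose [simp]: "id_blinfun o\<^sub>L T = T" "T o\<^sub>L id_blinfun = T"
  by (auto intro!: blinfun_eqI)

lemma compose_assoc: "(S o\<^sub>L T) o\<^sub>L R = S o\<^sub>L (T o\<^sub>L R)"
  by (auto intro!: blinfun_eqI)

lemma inner_cscale: "inner (cscale c f) h = inner f (cscale (cnj c) h)"
  by (simp add: inner_ell2_def mult_ac)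

lemma norm_cscale: "norm (cscale_ell2 c f) = cmod c * norm f"
  by (simp add: norm_ell2_eq norm_mult power_mult_distrib infsum_cmult_right' real_sqrt_mult)

lemma norm_cscale_compose:
  fixes T :: "'b ell2 \<Rightarrow>\<^sub>L 'a ell2"
  shows "norm (cscale c o\<^sub>L T) = cmod c * norm T"
proof (cases "c = 0")
  case False
  have le: "norm (cscale d o\<^sub>L R) \<le> cmod d * norm R" for d and R :: "'b ell2 \<Rightarrow>\<^sub>L 'a ell2"
    by (rule norm_blinfun_bound)
      (auto simp: norm_cscale mult.assoc intro!: mult_left_mono norm_blinfun)
  \<comment> \<open>The upper bound applied to \<open>inverse c\<close> gives the reverse
    inequality.\<close>
  have "T = cscale (inverse c) o\<^sub>L (cscale c o\<^sub>L T)"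
    using False by (simp flip: compose_assoc cscale_mult)
  then have "norm T \<le> cmod (inverse c) * norm (cscale c o\<^sub>L T)"
    using le by metis
  then have "cmod c * norm T \<le> norm (cscale c o\<^sub>L T)"
    using False by (simp add: norm_divide field_simps)
  then show ?thesis
    using le[of c T] by simp
qed auto

text \<open>The common form of \<open>regular_rep\<close> and \<open>left_right_rep\<close>, so that
  both are treated at once.\<close>

definition rep_of :: "('g \<Rightarrow> 'a ell2 \<Rightarrow>\<^sub>L 'a ell2) \<Rightarrow> ('g \<Rightarrow>\<^sub>0 complex) \<Rightarrow> 'a ell2 \<Rightarrow>\<^sub>L 'a ell2" where
  "rep_of U a = (\<Sum>g\<in>Poly_Mapping.keys a. cscale (Poly_Mapping.lookup a g) o\<^sub>L U g)"

lemma rep_of_superset: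
  assumes "finite K" "Poly_Mapping.keys a \<subseteq> K"
  shows "rep_of U a = (\<Sum>g\<in>K. cscale (Poly_Mapping.lookup a g) o\<^sub>L U g)"
  unfolding rep_of_def
  by (rule sum.mono_neutral_left) (use assms in \<open>auto simp: in_keys_iff\<close>)

lemma rep_of_add: "rep_of U (a + b) = rep_of U a + rep_of U b"
proof -
  let ?K = "Poly_Mapping.keys a \<union> Poly_Mapping.keys b"
  have "rep_of U (a + b) = (\<Sum>g\<in>?K. cscale (Poly_Mapping.lookup (a + b) g) o\<^sub>L U g)"
    by (rule rep_of_superset) (use Poly_Mapping.keys_add[of a b] in auto)
  also have "\<dots> = rep_of U a + rep_of U b"
    by (simp add: lookup_add cscale_add bounded_bilinear.add_left[OF bounded_bilinear_blinfun_compose]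
        sum.distrib rep_of_superset[of ?K])
  finally show ?thesis .
qed

lemma rep_of_zero [simp]: "rep_of U 0 = 0"
  by (simp add: rep_of_def)

lemma rep_of_single [simp]: "rep_of U (Poly_Mapping.single g c) = cscale c o\<^sub>L U g"
  by (subst rep_of_superset[of "{g}"]) auto

lemma rep_of_sum: "rep_of U (\<Sum>i\<in>I. a i) = (\<Sum>i\<in>I. rep_of U (a i))"
  by (induction I rule: infinite_finite_induct) (auto simp: rep_of_add)

lemma rep_of_diff: "rep_of U (a - b) = rep_of U a - rep_of U b"
  using rep_of_add[of U "a - b" b] by simp

lemma rep_of_scale: "rep_of U (galg_scale c a) = cscale c o\<^sub>L rep_of U a"
proof -
  have "rep_of U (galg_scale c a)
      = (\<Sum>g\<in>Poly_Mapping.keys a. cscale (Poly_Mapping.lookup (galg_scale c a) g) o\<^sub>L U g)"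
    by (rule rep_of_superset)
      (auto simp: galg_scale_def in_keys_iff Poly_Mapping.map.rep_eq when_def)
  also have "\<dots> = (\<Sum>g\<in>Poly_Mapping.keys a. cscale c o\<^sub>L (cscale (Poly_Mapping.lookup a g) o\<^sub>L U g))"
    by (intro sum.cong)
      (auto simp: galg_scale_def Poly_Mapping.map.rep_eq in_keys_iff cscale_mult compose_assoc)
  finally show ?thesis
    unfolding rep_of_def
    by (simp add: bounded_bilinear.sum_right[OF bounded_bilinear_blinfun_compose])
qed

lemma galg_sum_single:
  "a = (\<Sum>g\<in>Poly_Mapping.keys a. Poly_Mapping.single g (Poly_Mapping.lookup a g))"
  by (rule poly_mapping_eqI) (simp add: lookup_sum lookup_single when_def in_keys_iff)

text \<open>\<open>inner\<close> is the real inner product, which already determines the norm.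
  \<open>U_adj\<close> with \<open>U_add\<close> and \<open>U_zero\<close> makes the operators
  orthogonal, and \<open>U_cscale\<close> adds complex linearity.\<close>

locale unitary_rep =
  fixes U :: "'g::group_add \<Rightarrow> 'a ell2 \<Rightarrow>\<^sub>L 'a ell2"
  assumes U_zero: "U 0 = id_blinfun"
    and U_add: "U (g + h) = U g o\<^sub>L U h"
    and U_cscale: "U g o\<^sub>L cscale c = cscale c o\<^sub>L U g"
    and U_adj: "inner (U g f) k = inner f (U (- g) k)"
begin

lemma norm_U: "norm (U g f) = norm f"
proof -
  have "U (- g) (U g f) = f"
    using U_add[of "- g" g] by (simp add: U_zero flip: blinfun_apply_blinfun_compose)
  then show ?thesis
    by (simp add: norm_eq_sqrt_inner U_adj)
qed

lemma rep_of_one [simp]: "rep_of U 1 = id_blinfun"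
  by (simp add: U_zero flip: single_one)

lemma rep_of_mult: "rep_of U (a * b) = rep_of U a o\<^sub>L rep_of U b"
proof -
  interpret c: bounded_bilinear "(o\<^sub>L) :: ('a ell2 \<Rightarrow>\<^sub>L 'a ell2) \<Rightarrow> ('a ell2 \<Rightarrow>\<^sub>L 'a ell2) \<Rightarrow> _"
    by (rule bounded_bilinear_blinfun_compose)
  have comm: "cscale (c * d) o\<^sub>L U (g + h) = (cscale c o\<^sub>L U g) o\<^sub>L (cscale d o\<^sub>L U h)" for c d g h
    by (metis compose_assoc cscale_mult U_add U_cscale)
  have "a * b = (\<Sum>g\<in>Poly_Mapping.keys a. \<Sum>h\<in>Poly_Mapping.keys b.
      Poly_Mapping.single (g + h) (Poly_Mapping.lookup a g * Poly_Mapping.lookup b h))"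
    by (subst galg_sum_single[of a], subst galg_sum_single[of b])
      (simp add: sum_product mult_single)
  then have "rep_of U (a * b) = (\<Sum>g\<in>Poly_Mapping.keys a. \<Sum>h\<in>Poly_Mapping.keys b.
      (cscale (Poly_Mapping.lookup a g) o\<^sub>L U g) o\<^sub>L (cscale (Poly_Mapping.lookup b h) o\<^sub>L U h))"
    by (simp add: rep_of_sum comm)
  also have "\<dots> = rep_of U a o\<^sub>L rep_of U b"
    unfolding rep_of_def c.sum_left by (simp add: c.sum_right)
  finally show ?thesis .
qed

lemma rep_of_adj: "inner (rep_of U a f) k = inner f (rep_of U (galg_adj a) k)"
proof -
  have "inner ((cscale c o\<^sub>L U g) f) k = inner f ((cscale (cnj c) o\<^sub>L U (- g)) k)" for c g
    by (metis inner_cscale U_adj blinfun_apply_blinfun_compose U_cscale)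
  then show ?thesis
    by (simp add: rep_of_def[of U a] galg_adj_def rep_of_sum blinfun.sum_left
        inner_sum_left inner_sum_right del: blinfun_apply_blinfun_compose)
qed

text \<open>Since \<open>rep_of U (galg_adj a)\<close> is the adjoint of \<open>rep_of U a\<close>,
  Cauchy-Schwarz bounds its norm by that of \<open>rep_of U a\<close>, which is one half of the
  C*-identity. The other half is Cauchy-Schwarz applied to
  \<open>inner f (rep_of U (galg_adj a * a) f)\<close>.\<close>

lemma cstar_seminorm_rep: "cstar_seminorm (\<lambda>a. norm (rep_of U a))"
  unfolding cstar_seminorm_def
proof (intro conjI allI)
  fix a b c
  show "0 \<le> norm (rep_of U a)" by simp
  show "norm (rep_of U (a + b)) \<le> norm (rep_of U a) + norm (rep_of U b)"
    by (simp add: rep_of_add norm_triangle_ineq)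
  show "norm (rep_of U (galg_scale c a)) = cmod c * norm (rep_of U a)"
    by (simp add: rep_of_scale norm_cscale_compose)
  show mult: "norm (rep_of U (a * b)) \<le> norm (rep_of U a) * norm (rep_of U b)" for a b
    by (simp add: rep_of_mult norm_blinfun_compose)
  let ?A = "rep_of U a" and ?B = "rep_of U (galg_adj a)"
  have "norm ?B \<le> norm ?A"
  proof (rule norm_blinfun_bound)
    fix k
    have "(norm (?B k))\<^sup>2 = inner (?A (?B k)) k"
      by (simp add: rep_of_adj power2_norm_eq_inner)
    also have "\<dots> \<le> norm (?A (?B k)) * norm k" by (rule norm_cauchy_schwarz)
    also have "\<dots> \<le> (norm ?A * norm (?B k)) * norm k"
      by (intro mult_right_mono norm_blinfun) simp
    finally have "norm (?B k) * norm (?B k) \<le> norm (?B k) * (norm ?A * norm k)"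
      by (simp add: power2_eq_square mult_ac)
    then show "norm (?B k) \<le> norm ?A * norm k"
      by (cases "norm (?B k) = 0") (auto simp: mult_le_cancel_left)
  qed simp
  then have le: "norm (rep_of U (galg_adj a * a)) \<le> (norm ?A)\<^sup>2"
    using mult[of "galg_adj a" a] mult_right_mono[of "norm ?B" "norm ?A" "norm ?A"]
    by (simp add: power2_eq_square)
  have "norm ?A \<le> sqrt (norm (rep_of U (galg_adj a * a)))"
  proof (rule norm_blinfun_bound)
    fix f
    have "(norm (?A f))\<^sup>2 = inner f (rep_of U (galg_adj a * a) f)"
      by (simp add: rep_of_adj power2_norm_eq_inner rep_of_mult)
    also have "\<dots> \<le> norm f * norm (rep_of U (galg_adj a * a) f)" by (rule norm_cauchy_schwarz)
    also have "\<dots> \<le> norm f * (norm (rep_of U (galg_adj a * a)) * norm f)"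
      by (intro mult_left_mono norm_blinfun) simp
    also have "\<dots> = (sqrt (norm (rep_of U (galg_adj a * a))) * norm f)\<^sup>2"
      by (simp add: power_mult_distrib) (simp add: power2_eq_square)
    finally show "norm (?A f) \<le> sqrt (norm (rep_of U (galg_adj a * a))) * norm f"
      by (rule power2_le_imp_le) simp
  qed simp
  then have "(norm ?A)\<^sup>2 \<le> norm (rep_of U (galg_adj a * a))"
    using power_mono[of "norm ?A" _ 2] by fastforce
  with le show "norm (rep_of U (galg_adj a * a)) = (norm ?A)\<^sup>2" by simp
qed

text \<open>The operator norm is one of the seminorms in the supremum. Hence null sequences for
  \<open>full_norm\<close> are sent to null sequences of operators.\<close>

lemma norm_rep_le_full_norm: "norm (rep_of U a) \<le> full_norm a"
  unfolding full_norm_def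
  by (rule cSUP_upper[of "\<lambda>a. norm (rep_of U a)" _ "\<lambda>p. p a"])
    (auto simp: cstar_seminorm_rep intro!: bdd_aboveI2 full_norm_bound)

end

section \<open>The left regular and the left-right representation\<close>

lemma inner_ell2_pullback:
  assumes "bij s" "\<And>x. ell2_apply f' x = ell2_apply f (s x)" "\<And>x. ell2_apply h' x = ell2_apply h (s x)"
  shows "inner f' h' = inner f h"
  unfolding inner_ell2_def
  using infsum_reindex_bij_betw[of s UNIV UNIV "\<lambda>x. cnj (ell2_apply f x) * ell2_apply h x"] assms
  by simp

lemma lambda_op_zero: "lambda_op 0 = id_blinfun"
  by (auto intro!: blinfun_eqI ell2_eqI)

lemma minus_add_add: "- (g + h) + x = - h + (- g + x)" for g h x :: "'g::group_add"
  by (simp add: minus_add add.assoc del: add_uminus_conv_diff)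

lemma lambda_op_add: "lambda_op (g + h) = lambda_op g o\<^sub>L lambda_op h"
  by (auto intro!: blinfun_eqI ell2_eqI simp: minus_add_add)

lemma rho_op_zero: "rho_op 0 = id_blinfun"
  by (auto intro!: blinfun_eqI ell2_eqI)

interpretation regular: unitary_rep lambda_op
proof
  show "inner (lambda_op g f) k = inner f (lambda_op (- g) k)" for g :: 'a and f k
    by (rule inner_ell2_pullback[OF bij_left_translation[of g]]) (auto simp: algebra_simps)
qed (auto intro!: blinfun_eqI ell2_eqI simp: lambda_op_zero lambda_op_add)

interpretation left_right: unitary_rep "\<lambda>(g, h). lambda_op g o\<^sub>L rho_op h"
proof
  show "inner ((case g of (g, h) \<Rightarrow> lambda_op g o\<^sub>L rho_op h) f) k
      = inner f ((case - g of (g, h) \<Rightarrow> lambda_op g o\<^sub>L rho_op h) k)" for g :: "'a \<times> 'a" and f k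
  proof (cases g)
    case (Pair g1 g2)
    have "bij (\<lambda>x. - g1 + x + g2)"
      using bij_comp[OF bij_left_translation[of g1] bij_right_translation[of g2]]
      by (simp add: comp_def)
    then show ?thesis
      unfolding Pair by (intro inner_ell2_pullback) (auto simp: algebra_simps)
  qed
qed (auto intro!: blinfun_eqI ell2_eqI simp: lambda_op_zero rho_op_zero zero_prod_def minus_add_add add.assoc)

lemma regular_rep_eq: "regular_rep = rep_of lambda_op"
  by (simp add: fun_eq_iff regular_rep_def rep_of_def)

lemma left_right_rep_eq: "left_right_rep = rep_of (\<lambda>(g, h). lambda_op g o\<^sub>L rho_op h)"
  by (simp add: fun_eq_iff left_right_rep_def rep_of_def case_prod_unfold)

section \<open>The (AO)-property yields parametrices\<close>

lemma mem_coset_const: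
  "s \<in> null_seqs +>\<^bsub>cauchy_seqs\<^esub> t \<longleftrightarrow> (\<exists>h\<in>null_seqs. s = (\<lambda>n. h n + t n))"
  by (auto simp: a_r_coset_def' cauchy_seqs_def)

lemma full_norm_zero: "full_norm (0 :: 'g::group_add \<Rightarrow>\<^sub>0 complex) = 0"
proof (rule antisym)
  have ne: "Collect cstar_seminorm \<noteq> ({} :: (('g \<Rightarrow>\<^sub>0 complex) \<Rightarrow> real) set)"
    using regular.cstar_seminorm_rep by blast
  show "full_norm (0 :: 'g \<Rightarrow>\<^sub>0 complex) \<le> 0"
    unfolding full_norm_def by (rule cSUP_least[OF ne]) (use full_norm_bound[of _ 0] in auto)
  show "0 \<le> full_norm (0 :: 'g \<Rightarrow>\<^sub>0 complex)"
    using regular.norm_rep_le_full_norm[of 0] by simp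
qed

text \<open>Constant sequences embed the group algebra into its completion; the identity in the
  (AO)-property is used only at these classes.\<close>

lemma const_coset_in_full_cstar: "null_seqs +>\<^bsub>cauchy_seqs\<^esub> (\<lambda>n. a) \<in> carrier full_cstar"
proof -
  have "(\<lambda>n. a) \<in> carrier cauchy_seqs"
    by (simp add: cauchy_seqs_def full_norm_zero)
  then show ?thesis
    by (auto simp: full_cstar_def star_quot_def FactRing_def A_RCOSETS_def')
qed

text \<open>Members of the coset differ from the constant sequence by a null sequence, whose image
  tends to 0; the constant sequence itself belongs to the coset and pins down the limit.\<close>

lemma (in unitary_rep) full_extend_const:
  "full_extend (rep_of U) (null_seqs +>\<^bsub>cauchy_seqs\<^esub> (\<lambda>n. a)) = rep_of U a"
  unfolding full_extend_def
proof (rule the_equality)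
  show "\<forall>s\<in>null_seqs +>\<^bsub>cauchy_seqs\<^esub> (\<lambda>n. a). (\<lambda>n. rep_of U (s n)) \<longlonglongrightarrow> rep_of U a"
  proof
    fix s
    assume "s \<in> null_seqs +>\<^bsub>cauchy_seqs\<^esub> (\<lambda>n. a)"
    then obtain h where h: "h \<in> null_seqs" "s = (\<lambda>n. h n + a)"
      by (auto simp: mem_coset_const)
    have "(\<lambda>n. rep_of U (h n)) \<longlonglongrightarrow> 0"
      by (rule Lim_null_comparison[of _ "\<lambda>n. full_norm (h n)"])
        (use h in \<open>auto simp: null_seqs_def norm_rep_le_full_norm\<close>)
    then show "(\<lambda>n. rep_of U (s n)) \<longlonglongrightarrow> rep_of U a"
      unfolding h(2) rep_of_add by (auto intro: tendsto_eq_intros)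
  qed
next
  fix T
  assume "\<forall>s\<in>null_seqs +>\<^bsub>cauchy_seqs\<^esub> (\<lambda>n. a). (\<lambda>n. rep_of U (s n)) \<longlonglongrightarrow> T"
  moreover have "(\<lambda>n. a) \<in> null_seqs +>\<^bsub>cauchy_seqs\<^esub> (\<lambda>n. a)"
    unfolding mem_coset_const by (rule bexI[of _ "\<lambda>_. 0"]) (auto simp: null_seqs_def full_norm_zero)
  ultimately have "(\<lambda>n. rep_of U a) \<longlonglongrightarrow> T" by auto
  then show "T = rep_of U a"
    by (simp add: LIMSEQ_const_iff)
qed

text \<open>The partial sums lie in the image of the group algebra, hence the inverse lies in its
  closure. For the regular representation this closure is the reduced C*-algebra, so a homomorphism
  defined there can be applied to the inverse.\<close>

lemma (in unitary_rep) neumann_series: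
  assumes "norm (rep_of U a) < 1"
  obtains B where "B \<in> closure (range (rep_of U))" "B o\<^sub>L rep_of U (1 - a) = id_blinfun"
proof -
  \<comment> \<open>Exponents start at 1, so that the norm of the identity operator does not
    enter.\<close>
  have pow: "norm (rep_of U (a ^ Suc k)) \<le> norm (rep_of U a) ^ Suc k" for k
  proof (induction k)
    case (Suc k)
    have "norm (rep_of U (a ^ Suc (Suc k))) \<le> norm (rep_of U a) * norm (rep_of U (a ^ Suc k))"
      using norm_blinfun_compose by (subst power_Suc) (simp only: rep_of_mult)
    also have "\<dots> \<le> norm (rep_of U a) * norm (rep_of U a) ^ Suc k"
      by (intro mult_left_mono Suc) simp
    finally show ?case by simp
  qed simp
  have "summable (\<lambda>k. norm (rep_of U a) ^ Suc k)"
    using assms by (simp add: summable_geometric)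
  then have "summable (\<lambda>k. rep_of U (a ^ Suc k))"
    by (rule summable_comparison_test[rotated]) (use pow in blast)
  then have summ: "summable (\<lambda>k. rep_of U (a ^ k))"
    using summable_Suc_iff[of "\<lambda>k. rep_of U (a ^ k)"] by blast
  define B where "B = suminf (\<lambda>k. rep_of U (a ^ k))"
  have B: "(\<lambda>n. rep_of U (\<Sum>k<n. a ^ k)) \<longlonglongrightarrow> B"
    unfolding B_def rep_of_sum by (rule summable_LIMSEQ[OF summ])
  show thesis
  proof
    show "B \<in> closure (range (rep_of U))"
      unfolding closure_sequential
      by (rule exI[of _ "\<lambda>n. rep_of U (\<Sum>k<n. a ^ k)"]) (simp add: B)
    have "(\<Sum>k<n. a ^ k) * (1 - a) = 1 - a ^ n" for n
    proof (induction n)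
      case (Suc n)
      then have "(\<Sum>k<Suc n. a ^ k) * (1 - a) = 1 - a ^ n + a ^ n * (1 - a)"
        by (simp only: sum.lessThan_Suc distrib_right)
      then show ?case
        by (simp only: right_diff_distrib power_Suc2 mult_1_right) simp
    qed simp
    then have "rep_of U (\<Sum>k<n. a ^ k) o\<^sub>L rep_of U (1 - a) = id_blinfun - rep_of U (a ^ n)" for n
      unfolding rep_of_mult[symmetric] by (simp only: rep_of_diff rep_of_one)
    moreover have "(\<lambda>n. id_blinfun - rep_of U (a ^ n)) \<longlonglongrightarrow> id_blinfun - 0"
      by (intro tendsto_intros summable_LIMSEQ_zero[OF summ])
    moreover have "(\<lambda>n. (rep_of U (\<Sum>k<n. a ^ k) o\<^sub>L rep_of U (1 - a))) \<longlonglongrightarrow> (B o\<^sub>L rep_of U (1 - a))"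
      by (intro bounded_bilinear.tendsto[OF bounded_bilinear_blinfun_compose] B tendsto_const)
    ultimately show "B o\<^sub>L rep_of U (1 - a) = id_blinfun"
      using LIMSEQ_unique by auto
  qed
qed

section \<open>Representatives of classes in the Calkin algebra\<close>

lemma mem_calkin_proj: "T \<in> calkin_proj S \<longleftrightarrow> (\<exists>K\<in>compact_ops. T = K + S)"
  by (auto simp: calkin_proj_def a_r_coset_def' bounded_ops_def)

lemma zero_compact_ops: "0 \<in> compact_ops"
proof -
  have "blinfun_apply (0 :: 'a ell2 \<Rightarrow>\<^sub>L 'a ell2) ` cball 0 1 = {0}"
    by (auto simp: image_iff intro!: exI[of _ 0])
  then show ?thesis
    by (simp add: compact_ops_def complex_linear_ops_def)
qed

text \<open>The product of two cosets contains the products of their representatives by the very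
  definition of \<^const>\<open>rcoset_mult\<close>, so the ideal property of the compact operators plays no role.\<close>

lemma AO_property_parametrix:
  fixes a :: "'g::group_add \<times> 'g \<Rightarrow>\<^sub>0 complex"
  assumes "AO_property TYPE('g)" "norm (regular_rep a) < 1"
  obtains S K where "K \<in> compact_ops" "S o\<^sub>L left_right_rep (1 - a) = K + id_blinfun"
proof -
  obtain \<phi> where hom: "\<phi> \<in> star_hom (reduced_cstar :: (('g \<times> 'g) ell2 \<Rightarrow>\<^sub>L ('g \<times> 'g) ell2) star_algebra)
       (calkin :: ('g ell2 \<Rightarrow>\<^sub>L 'g ell2) set star_algebra)"
    and \<phi>: "\<And>X. X \<in> carrier full_cstar \<Longrightarrow> \<phi> (canonical_surj X) = left_right_calkin X"
    using assms(1) unfolding AO_property_def by blast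
  have ring: "\<phi> \<in> ring_hom reduced_cstar calkin"
    using hom by (simp add: star_hom_def)
  have rep: "\<phi> (regular_rep b) = calkin_proj (left_right_rep b)" for b
    using \<phi>[OF const_coset_in_full_cstar[of b]]
    by (simp add: canonical_surj_def left_right_calkin_def regular_rep_eq left_right_rep_eq
        regular.full_extend_const left_right.full_extend_const)
  obtain B where B: "B \<in> closure (range regular_rep)" "B o\<^sub>L regular_rep (1 - a) = id_blinfun"
    using regular.neumann_series assms(2) unfolding regular_rep_eq by metis
  have car: "carrier reduced_cstar = closure (range (regular_rep :: ('g \<times> 'g \<Rightarrow>\<^sub>0 complex) \<Rightarrow> _))"
    by (simp add: reduced_cstar_def)
  \<comment> \<open>\<open>B\<close> is only a limit of images of group algebra elements, so nothing
    explicit is known about \<open>\<phi> B\<close>; any lift \<open>S\<close> of it serves.\<close>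
  have "\<phi> B \<in> carrier calkin"
    using ring_hom_closed[OF ring] B by (simp add: car)
  then obtain S where S: "\<phi> B = calkin_proj S"
    by (auto simp: calkin_def star_quot_def FactRing_def A_RCOSETS_def' calkin_proj_def)
  have "regular_rep (1 - a) \<in> closure (range regular_rep)"
    by (rule subsetD[OF closure_subset]) simp
  then have "\<phi> (B \<otimes>\<^bsub>reduced_cstar\<^esub> regular_rep (1 - a)) = \<phi> B \<otimes>\<^bsub>calkin\<^esub> \<phi> (regular_rep (1 - a))"
    using ring_hom_mult[OF ring] B by (simp add: car)
  moreover have "B \<otimes>\<^bsub>reduced_cstar\<^esub> regular_rep (1 - a) = \<one>\<^bsub>reduced_cstar\<^esub>"
    using B by (simp add: reduced_cstar_def bounded_ops_def)
  ultimately have "calkin_proj S \<otimes>\<^bsub>calkin\<^esub> calkin_proj (left_right_rep (1 - a)) = \<one>\<^bsub>calkin\<^esub>"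
    using ring_hom_one[OF ring] S rep by simp
  \<comment> \<open>The product of the two cosets is the unit coset, so this member of it differs
    from the identity by a compact operator.\<close>
  moreover have "S o\<^sub>L left_right_rep (1 - a)
      \<in> calkin_proj S \<otimes>\<^bsub>calkin\<^esub> calkin_proj (left_right_rep (1 - a))"
  proof -
    have self: "T \<in> calkin_proj T" for T :: "'g ell2 \<Rightarrow>\<^sub>L 'g ell2"
      unfolding mem_calkin_proj using zero_compact_ops by (rule bexI[rotated]) simp
    have "calkin_proj S \<otimes>\<^bsub>calkin\<^esub> calkin_proj T = (\<Union>x\<in>calkin_proj S. \<Union>y\<in>calkin_proj T. calkin_proj (x o\<^sub>L y))"
      for T
      by (simp add: calkin_def star_quot_def FactRing_def rcoset_mult_def calkin_proj_def)
        (simp add: bounded_ops_def)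
    then show ?thesis using self by blast
  qed
  moreover have "\<one>\<^bsub>calkin\<^esub> = calkin_proj (id_blinfun :: 'g ell2 \<Rightarrow>\<^sub>L 'g ell2)"
    by (simp add: calkin_def star_quot_def FactRing_def calkin_proj_def) (simp add: bounded_ops_def)
  ultimately have "S o\<^sub>L left_right_rep (1 - a) \<in> calkin_proj id_blinfun" by simp
  then show thesis
    using that unfolding mem_calkin_proj by blast
qed

section \<open>Compact operators on vectors with remote support\<close>

text \<open>By the Riesz theorem \<open>\<phi>\<close> is the inner product with a vector, and
  \<open>E\<close> would carry most of that vector. The argument replaces the representing vector by
  a near-maximiser of \<open>\<phi>\<close> on the unit ball.\<close>

lemma functional_small_off_finite:
  fixes \<phi> :: "'a ell2 \<Rightarrow> real"
  assumes "bounded_linear \<phi>" "0 < e"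
  obtains E where "finite E" "\<And>f. restr E f = 0 \<Longrightarrow> \<phi> f \<le> e * norm f"
proof -
  interpret bounded_linear \<phi> by fact
  define a where "a = onorm \<phi>"
  have a: "\<phi> f \<le> a * norm f" for f
    using onorm[OF assms(1), of f] by (simp add: a_def)
  have "0 \<le> a" unfolding a_def by (rule onorm_pos_le[OF assms(1)])
  show thesis
  proof (cases "a = 0")
    case True
    show thesis
    proof (rule that[of "{}"])
      show "\<phi> f \<le> e * norm f" for f
        using a[of f] True assms(2) by (simp add: order_trans[of _ 0])
    qed simp
  next
    case False
    text \<open>If \<open>u\<close> with finite support \<open>E\<close> almost attains the norm \<open>a\<close> of \<open>\<phi>\<close>, then \<open>\<phi>\<close> is small
      on unit vectors \<open>f\<close> orthogonal to \<open>u\<close>, because \<open>\<phi> (u + s f) \<le> a (1 + s\<^sup>2 / 2)\<close>.\<close>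
    define s where "s = e / a"
    define d where "d = s * e / 2"
    have pos: "0 < a" "0 < s" "0 < d" using False \<open>0 \<le> a\<close> assms(2) by (auto simp: s_def d_def)
    \<comment> \<open>Otherwise, by homogeneity, \<open>a - d / 2\<close> would bound
      \<open>\<phi>\<close> although it is below the operator norm; evaluation at \<open>0\<close>
      shows that this bound is nonnegative.\<close>
    have "\<exists>u0. norm u0 \<le> 1 \<and> a - d / 2 < \<phi> u0"
    proof (rule ccontr)
      assume "\<not> ?thesis"
      then have b: "\<phi> f \<le> a - d / 2" if "norm f \<le> 1" for f
        using that by (meson not_le)
      have b': "\<phi> f \<le> (a - d / 2) * norm f" for f
        using b[of "inverse (norm f) *\<^sub>R f"] by (cases "f = 0") (simp_all add: scaleR zero field_simps)
      have "norm (\<phi> f) \<le> (a - d / 2) * norm f" for f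
        using b'[of f] b'[of "- f"] by (simp add: neg abs_le_iff)
      then have "a \<le> a - d / 2"
        unfolding a_def[symmetric] using b[of 0] by (subst a_def) (rule onorm_bound, simp_all add: zero)
      then show False using pos by simp
    qed
    then obtain u0 where u0: "norm u0 \<le> 1" "a - d / 2 < \<phi> u0" by blast
    \<comment> \<open>Half of the margin \<open>d\<close> went into the choice of \<open>u0\<close>;
      the other half pays for truncating it to a finite support.\<close>
    obtain E where E: "finite E" "norm (u0 - restr E u0) < d / (2 * a)"
      using restr_finite_approx pos by (metis divide_pos_pos mult_pos_pos zero_less_numeral)
    define u where "u = restr E u0"
    have u1: "norm u \<le> 1" unfolding u_def using norm_restr_le u0(1) by (rule order_trans)
    have "\<phi> u0 - \<phi> u \<le> a * norm (u0 - u)"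
      using a[of "u0 - u"] by (simp add: diff)
    also have "\<dots> \<le> a * (d / (2 * a))"
      using E(2) pos by (intro mult_left_mono) (auto simp: u_def)
    also have "\<dots> = d / 2" using pos by simp
    finally have u: "a - d \<le> \<phi> u" using u0(2) by simp
    have unit: "\<phi> f \<le> e" if f: "restr E f = 0" "norm f = 1" for f
    proof -
      have "inner u f = 0"
      proof (rule inner_ell2_disjoint)
        fix x
        show "ell2_apply u x = 0 \<or> ell2_apply f x = 0"
          using arg_cong[OF f(1), of "\<lambda>f. ell2_apply f x"] by (auto simp: u_def)
      qed
      then have "(norm (u + s *\<^sub>R f))\<^sup>2 = (norm u)\<^sup>2 + s\<^sup>2"
        using f(2) by (simp add: power2_norm_eq_inner inner_simps inner_commute)
          (simp add: power2_eq_square norm_eq_1)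
      also have "\<dots> \<le> (1 + s\<^sup>2 / 2)\<^sup>2"
        using power_mono[OF u1, of 2] by (simp add: power2_sum add_increasing2)
      finally have n: "norm (u + s *\<^sub>R f) \<le> 1 + s\<^sup>2 / 2"
        by (rule power2_le_imp_le) (simp add: pos)
      have "a - d + s * \<phi> f \<le> \<phi> (u + s *\<^sub>R f)"
        using u by (simp add: add scaleR)
      also have "\<dots> \<le> a * (1 + s\<^sup>2 / 2)"
        using a[of "u + s *\<^sub>R f"] mult_left_mono[OF n \<open>0 \<le> a\<close>] by simp
      finally have "s * \<phi> f \<le> d + a * s\<^sup>2 / 2" by (simp add: algebra_simps)
      \<comment> \<open>This dictates the choice of \<open>s\<close> and \<open>d\<close>: both
        summands become \<open>s * e / 2\<close>.\<close>
      also have "\<dots> = s * e"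
        using pos by (simp add: d_def s_def power2_eq_square field_simps)
      finally show "\<phi> f \<le> e" using pos by simp
    qed
    show thesis
    proof (rule that[OF E(1)])
      fix f
      assume f: "restr E f = 0"
      show "\<phi> f \<le> e * norm f"
      proof (cases "f = 0")
        case False
        have "restr E (inverse (norm f) *\<^sub>R f) = inverse (norm f) *\<^sub>R restr E f"
          by (rule ell2_eqI) auto
        then show ?thesis
          using unit[of "inverse (norm f) *\<^sub>R f"] f False by (simp add: scaleR field_simps)
      qed (simp add: zero)
    qed
  qed
qed

text \<open>The image of the unit ball stays within 1/8 of a finite set \<open>V\<close>. Off a
  finite set every \<open>inner (K f) v\<close> with \<open>v\<close> in \<open>V\<close> is small,
  and the square of \<open>norm (K f)\<close> is \<open>inner (K f) v\<close> plus
  \<open>inner (K f) (K f - v)\<close>, the latter being controlled by the distance to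
  \<open>v\<close>.\<close>

lemma compact_op_small_off_finite:
  assumes "K \<in> compact_ops"
  obtains E where "finite E" "\<And>f. restr E f = 0 \<Longrightarrow> norm (blinfun_apply K f) \<le> norm f / 2"
proof -
  have "compact (closure (blinfun_apply K ` cball 0 1))"
    using assms by (simp add: compact_ops_def)
  then obtain V where V: "finite V"
    "closure (blinfun_apply K ` cball 0 1) \<subseteq> (\<Union>v\<in>V. ball v (1 / 8))"
    unfolding compact_eq_totally_bounded by (metis zero_less_divide_1_iff zero_less_numeral)
  have "\<exists>E. finite E \<and> (\<forall>f. restr E f = 0 \<longrightarrow> inner (blinfun_apply K f) v \<le> 1 / 8 * norm f)" for v
    by (rule functional_small_off_finite[of "\<lambda>f. inner (blinfun_apply K f) v" "1 / 8"])
      (auto intro!: bounded_linear_intros)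
  then obtain E where E: "\<And>v. finite (E v)"
    "\<And>v f. restr (E v) f = 0 \<Longrightarrow> inner (blinfun_apply K f) v \<le> 1 / 8 * norm f"
    by metis
  have unit: "norm (blinfun_apply K f) \<le> 1 / 2" if f: "restr (\<Union>v\<in>V. E v) f = 0" "norm f = 1" for f
  proof -
    have "blinfun_apply K f \<in> closure (blinfun_apply K ` cball 0 1)"
      by (rule subsetD[OF closure_subset]) (use f in auto)
    then obtain v where v: "v \<in> V" "norm (blinfun_apply K f - v) \<le> 1 / 8"
      using V(2) by (auto simp: dist_norm norm_minus_commute dest!: subsetD)
    have "restr (E v) f = 0"
    proof (rule ell2_eqI)
      fix x
      show "ell2_apply (restr (E v) f) x = ell2_apply 0 x"
        using arg_cong[OF f(1), of "\<lambda>f. ell2_apply f x"] v(1) by (auto split: if_splits)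
    qed
    then have "inner (blinfun_apply K f) v \<le> 1 / 8"
      using E(2)[of v f] f(2) by simp
    moreover have "inner (blinfun_apply K f) (blinfun_apply K f - v) \<le> norm (blinfun_apply K f) * (1 / 8)"
      using norm_cauchy_schwarz[of "blinfun_apply K f" "blinfun_apply K f - v"] v(2)
      by (meson mult_left_mono norm_ge_zero order_trans)
    ultimately have "(norm (blinfun_apply K f))\<^sup>2 \<le> 1 / 8 + norm (blinfun_apply K f) * (1 / 8)"
      by (simp add: power2_norm_eq_inner inner_diff_right)
    \<comment> \<open>Completing the square: 1/8 + 1/256 is at most the square of 7/16, and 7/16 +
      1/16 = 1/2.\<close>
    then have "(norm (blinfun_apply K f) - 1 / 16)\<^sup>2 \<le> (7 / 16)\<^sup>2"
      by (simp add: power2_diff) (simp add: power2_eq_square)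
    then have "norm (blinfun_apply K f) - 1 / 16 \<le> 7 / 16"
      by (rule power2_le_imp_le) simp
    then show ?thesis by simp
  qed
  show thesis
  proof (rule that[of "\<Union>v\<in>V. E v"])
    fix f
    assume f: "restr (\<Union>v\<in>V. E v) f = 0"
    show "norm (blinfun_apply K f) \<le> norm f / 2"
    proof (cases "f = 0")
      case False
      have "restr (\<Union>v\<in>V. E v) (inverse (norm f) *\<^sub>R f) = inverse (norm f) *\<^sub>R restr (\<Union>v\<in>V. E v) f"
        by (rule ell2_eqI) auto
      then show ?thesis
        using unit[of "inverse (norm f) *\<^sub>R f"] f False by (simp add: blinfun.scaleR_right field_simps)
    qed simp
  qed (use V E in auto)
qed

section \<open>Spectral gaps\<close>

text \<open>By Tychonoff, set functions with values in [0, 1] form a compact space. A cluster point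
  of the sequence inherits positivity, total mass and additivity, and becomes exactly
  invariant.\<close>

lemma amenable_of_approximate_means:
  fixes m :: "nat \<Rightarrow> 'g::group_add set \<Rightarrow> real"
  assumes nonneg: "\<And>n A. 0 \<le> m n A" and total: "\<And>n. m n UNIV = 1"
    and add: "\<And>n A B. A \<inter> B = {} \<Longrightarrow> m n (A \<union> B) = m n A + m n B"
    and inv: "\<And>g A. (\<lambda>n. m n ((+) g ` A) - m n A) \<longlonglongrightarrow> 0"
  shows "amenable TYPE('g)"
proof -
  have le_1: "m n A \<le> 1" for n A
    using add[of A "- A" n] nonneg[of n "- A"] total[of n] by simp
  have "compact (PiE UNIV (\<lambda>_ :: 'g set. {0..1 :: real}))"
    using compactin_PiE[of "\<lambda>_ :: 'g set. euclidean :: real topology" UNIV "\<lambda>_. {0..1}"]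
    by (simp add: euclidean_product_topology)
  moreover have "filtermap m sequentially \<noteq> bot"
    by (simp add: filtermap_bot_iff)
  moreover have "eventually (\<lambda>x. x \<in> PiE UNIV (\<lambda>_. {0..1})) (filtermap m sequentially)"
    by (simp add: eventually_filtermap PiE_UNIV_domain nonneg le_1)
  ultimately obtain \<mu> where \<mu>: "inf (nhds \<mu>) (filtermap m sequentially) \<noteq> bot"
    unfolding compact_filter by blast
  \<comment> \<open>\<open>G\<close> refines both the sequence and the neighbourhoods of the cluster
    point, so relations valid along the sequence pass to \<open>\<mu>\<close> by limits along
    \<open>G\<close>.\<close>
  define G where "G = inf (nhds \<mu>) (filtermap m sequentially)"
  have lim: "((\<lambda>\<nu>. \<nu> A) \<longlongrightarrow> \<mu> A) G" for A
  proof (rule tendsto_mono)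
    show "G \<le> nhds \<mu>" by (simp add: G_def)
    show "((\<lambda>\<nu>. \<nu> A) \<longlongrightarrow> \<mu> A) (nhds \<mu>)"
    proof (rule topological_tendstoI)
      fix S :: "real set"
      assume "open S" "\<mu> A \<in> S"
      then show "eventually (\<lambda>\<nu>. \<nu> A \<in> S) (nhds \<mu>)"
        using open_vimage[OF _ continuous_on_product_coordinates, of S A] unfolding eventually_nhds
        by (intro exI[of _ "(\<lambda>\<nu>. \<nu> A) -` S"]) auto
    qed
  qed
  have G: "G \<le> filtermap m sequentially" "G \<noteq> bot"
    using \<mu> by (simp_all add: G_def)
  have ev: "eventually P G" if "\<And>n. P (m n)" for P
    by (rule filter_leD[OF G(1)]) (simp add: eventually_filtermap that)
  have "0 \<le> \<mu> A" for A
    by (rule tendsto_lowerbound[OF lim ev G(2)]) (rule nonneg)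
  moreover have "\<mu> UNIV = 1"
    by (rule tendsto_unique[OF G(2) lim tendsto_eventually]) (rule ev, rule total)
  moreover have "\<mu> (A \<union> B) = \<mu> A + \<mu> B" if "A \<inter> B = {}" for A B
  proof -
    have "((\<lambda>\<nu>. \<nu> (A \<union> B) - (\<nu> A + \<nu> B)) \<longlongrightarrow> \<mu> (A \<union> B) - (\<mu> A + \<mu> B)) G"
      by (intro tendsto_intros lim)
    moreover have "((\<lambda>\<nu>. \<nu> (A \<union> B) - (\<nu> A + \<nu> B)) \<longlongrightarrow> 0) G"
      by (rule tendsto_eventually) (rule ev, simp add: add[OF that])
    ultimately show ?thesis
      using tendsto_unique[OF G(2)] by fastforce
  qed
  moreover have "\<mu> ((+) g ` A) = \<mu> A" for g A
  proof -
    have "((\<lambda>\<nu>. \<nu> ((+) g ` A) - \<nu> A) \<longlongrightarrow> \<mu> ((+) g ` A) - \<mu> A) G"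
      by (intro tendsto_intros lim)
    moreover have "((\<lambda>\<nu>. \<nu> ((+) g ` A) - \<nu> A) \<longlongrightarrow> 0) G"
      by (rule tendsto_mono[OF G(1)]) (use inv in \<open>simp add: filterlim_filtermap\<close>)
    ultimately show ?thesis
      using tendsto_unique[OF G(2)] by fastforce
  qed
  ultimately show ?thesis
    unfolding amenable_def by blast
qed

text \<open>The squared absolute values of a unit vector are a probability density on the product
  group. Its first marginal serves as approximate mean, because \<open>(g, g)\<close> acts on the
  first coordinate as translation by \<open>g\<close>.\<close>

lemma amenable_of_almost_invariant_vectors:
  fixes \<xi> :: "nat \<Rightarrow> ('g::group_add \<times> 'g) ell2"
  assumes unit: "\<And>n. norm (\<xi> n) = 1"
    and inv: "\<And>g. (\<lambda>n. norm (lambda_op (g, g) (\<xi> n) - \<xi> n)) \<longlonglongrightarrow> 0"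
  shows "amenable TYPE('g)"
proof (rule amenable_of_approximate_means[of "\<lambda>n A. (norm (restr (A \<times> UNIV) (\<xi> n)))\<^sup>2"])
  fix n and A B :: "'g set"
  show "0 \<le> (norm (restr (A \<times> UNIV) (\<xi> n)))\<^sup>2" by simp
  show "(norm (restr (UNIV \<times> UNIV) (\<xi> n)))\<^sup>2 = 1" by (simp add: unit)
  assume "A \<inter> B = {}"
  then show "(norm (restr ((A \<union> B) \<times> UNIV) (\<xi> n)))\<^sup>2
      = (norm (restr (A \<times> UNIV) (\<xi> n)))\<^sup>2 + (norm (restr (B \<times> UNIV) (\<xi> n)))\<^sup>2"
    unfolding Sigma_Un_distrib1 by (intro norm_restr_Un) auto
next
  fix g and A :: "'g set"
  let ?P = "restr (A \<times> UNIV)"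
  \<comment> \<open>Translating \<open>A\<close> by \<open>g\<close> amounts to translating the
    vector by \<open>- g\<close>, up to the isometry \<open>lambda_op (g, g)\<close>.\<close>
  let ?u = "\<lambda>n. lambda_op (- g, - g) (\<xi> n)"
  have "norm ((norm (restr (((+) g ` A) \<times> UNIV) (\<xi> n)))\<^sup>2 - (norm (?P (\<xi> n)))\<^sup>2)
      \<le> 2 * norm (?u n - \<xi> n)" for n
  proof -
    have "restr (((+) g ` A) \<times> UNIV) (\<xi> n) = lambda_op (g, g) (?P (?u n))"
    proof (rule ell2_eqI)
      fix x :: "'g \<times> 'g"
      obtain y z where x: "x = (y, z)" by (cases x)
      have "y \<in> (+) g ` A \<longleftrightarrow> - g + y \<in> A"
        by (force simp: image_iff simp flip: add.assoc)
      then show "ell2_apply (restr (((+) g ` A) \<times> UNIV) (\<xi> n)) x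
          = ell2_apply (lambda_op (g, g) (?P (?u n))) x"
        by (simp add: x flip: add.assoc)
    qed
    then have eq: "norm (restr (((+) g ` A) \<times> UNIV) (\<xi> n)) = norm (?P (?u n))"
      by (simp only: regular.norm_U)
    have 1: "norm (?P (?u n)) \<le> 1" "norm (?P (\<xi> n)) \<le> 1"
      using norm_restr_le[of "A \<times> UNIV" "?u n"] norm_restr_le[of "A \<times> UNIV" "\<xi> n"]
      by (simp_all only: regular.norm_U unit)
    have "\<bar>norm (?P (?u n)) - norm (?P (\<xi> n))\<bar> \<le> norm (?P (?u n - \<xi> n))"
      unfolding restr_diff by (rule norm_triangle_ineq3)
    also have "\<dots> \<le> norm (?u n - \<xi> n)" by (rule norm_restr_le)
    finally have 2: "\<bar>norm (?P (?u n)) - norm (?P (\<xi> n))\<bar> \<le> norm (?u n - \<xi> n)" .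
    have "norm ((norm (?P (?u n)))\<^sup>2 - (norm (?P (\<xi> n)))\<^sup>2)
        = \<bar>norm (?P (?u n)) + norm (?P (\<xi> n))\<bar> * \<bar>norm (?P (?u n)) - norm (?P (\<xi> n))\<bar>"
      by (simp only: real_norm_def power2_eq_square square_diff_square_factored abs_mult)
    also have "\<dots> \<le> 2 * norm (?u n - \<xi> n)"
      using 1 2 by (intro mult_mono) auto
    finally show ?thesis unfolding eq .
  qed
  moreover have "(\<lambda>n. 2 * norm (?u n - \<xi> n)) \<longlonglongrightarrow> 0"
    using tendsto_mult_left[OF inv[of "- g"], of 2] by simp
  ultimately show "(\<lambda>n. (norm (restr (((+) g ` A) \<times> UNIV) (\<xi> n)))\<^sup>2 - (norm (?P (\<xi> n)))\<^sup>2) \<longlonglongrightarrow> 0"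
    by (rule Lim_null_comparison[OF always_eventually[OF allI]])
qed

text \<open>Without a gap, near-maximisers of the averages over finite sets exhausting the group are
  almost invariant by \<open>unit_vectors_close\<close>; \<open>0 \<in> F\<close> allows the
  comparison of a translate with the vector itself. Diagonal elements are taken because the
  left-right representation turns them into conjugations. The symmetry of \<open>F\<close> serves
  \<open>no_superharmonic\<close>.\<close>

lemma nonamenable_spectral_gap:
  assumes count: "countable (UNIV :: 'g::group_add set)" and "\<not> amenable TYPE('g)"
  obtains F :: "'g::group_add set" and s :: real where "finite F" "0 \<in> F" "uminus ` F = F" "s < 1"
    "\<And>f. norm (\<Sum>g\<in>F. lambda_op (g, g) f) \<le> s * real (card F) * norm f"
proof (rule ccontr)
  assume contr: "\<not> thesis"
  note gap = that
  define F :: "nat \<Rightarrow> 'g set" where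
    "F n = insert 0 (from_nat_into UNIV ` {..n} \<union> uminus ` from_nat_into UNIV ` {..n})" for n
  have F: "finite (F n)" "0 \<in> F n" "uminus ` F n = F n" for n
    by (auto simp: F_def image_Un image_image)
  have ex_F: "\<exists>N. \<forall>n\<ge>N. g \<in> F n" for g
  proof -
    obtain N where "g = from_nat_into UNIV N"
      using from_nat_into_surj[OF count, of g] by auto
    then show ?thesis by (intro exI[of _ N]) (auto simp: F_def)
  qed
  have "\<exists>\<xi> :: ('g \<times> 'g) ell2. norm \<xi> = 1 \<and> (\<forall>g\<in>F n. norm (lambda_op (g, g) \<xi> - \<xi>) \<le> 1 / real (Suc n))" for n
  proof -
    define c where "c = real (card (F n))"
    have c: "0 < c" using F[of n] by (auto simp: c_def card_gt_0_iff)
    \<comment> \<open>Chosen so that \<open>4 * (c - s * c)\<close> is the square of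
      \<open>1 / real (Suc n)\<close>.\<close>
    define s where "s = 1 - (1 / real (Suc n))\<^sup>2 / (4 * c)"
    have "s < 1" using c by (simp add: s_def)
    then obtain f :: "('g \<times> 'g) ell2"
      where f: "s * c * norm f < norm (\<Sum>g\<in>F n. lambda_op (g, g) f)"
      using contr gap[OF F] unfolding c_def by (meson not_le)
    define \<xi> where "\<xi> = inverse (norm f) *\<^sub>R f"
    have "f \<noteq> 0" using f by (auto simp: blinfun.zero_right simp del: lambda_op.rep_eq)
    have "(\<Sum>g\<in>F n. lambda_op (g, g) \<xi>) = inverse (norm f) *\<^sub>R (\<Sum>g\<in>F n. lambda_op (g, g) f)"
      by (simp only: \<xi>_def blinfun.scaleR_right scaleR_sum_right)
    then have lower: "s * c \<le> norm (\<Sum>g\<in>F n. lambda_op (g, g) \<xi>)"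
      using f \<open>f \<noteq> 0\<close> by (simp add: field_simps)
    have "norm \<xi> = 1" using \<open>f \<noteq> 0\<close> by (simp add: \<xi>_def)
    moreover have "norm (lambda_op (g, g) \<xi> - \<xi>) \<le> 1 / real (Suc n)" if "g \<in> F n" for g
    proof (rule power2_le_imp_le)
      have "(norm (lambda_op (g, g) \<xi> - lambda_op (0, 0) \<xi>))\<^sup>2
          \<le> 4 * (c - norm (\<Sum>g\<in>F n. lambda_op (g, g) \<xi>))"
        unfolding c_def
        by (rule unit_vectors_close[OF F(1) that F(2)]) (simp only: regular.norm_U \<open>norm \<xi> = 1\<close>)
      also have "\<dots> \<le> 4 * (c - s * c)" using lower by simp
      also have "\<dots> = (1 / real (Suc n))\<^sup>2" using c by (simp add: s_def field_simps)
      finally show "(norm (lambda_op (g, g) \<xi> - \<xi>))\<^sup>2 \<le> (1 / real (Suc n))\<^sup>2"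
        using lambda_op_zero by (metis blinfun_apply_id_blinfun id_apply zero_prod_def)
    qed simp
    ultimately show ?thesis by blast
  qed
  then obtain \<xi> :: "nat \<Rightarrow> ('g \<times> 'g) ell2" where \<xi>: "\<And>n. norm (\<xi> n) = 1"
    "\<And>n g. g \<in> F n \<Longrightarrow> norm (lambda_op (g, g) (\<xi> n) - \<xi> n) \<le> 1 / real (Suc n)"
    by metis
  have "(\<lambda>n. norm (lambda_op (g, g) (\<xi> n) - \<xi> n)) \<longlonglongrightarrow> 0" for g
  proof (rule Lim_null_comparison)
    show "eventually (\<lambda>n. norm (norm (lambda_op (g, g) (\<xi> n) - \<xi> n)) \<le> 1 / real (Suc n)) sequentially"
      using ex_F[of g] \<xi>(2) unfolding eventually_sequentially by auto
    show "(\<lambda>n. 1 / real (Suc n)) \<longlonglongrightarrow> (0 :: real)"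
      using LIMSEQ_inverse_real_of_nat by (simp add: inverse_eq_divide)
  qed
  then have "amenable TYPE('g)"
    using \<xi>(1) by (intro amenable_of_almost_invariant_vectors)
  with assms(2) show False ..
qed

text \<open>On unit vectors \<open>f\<close> supported off \<open>E\<close> the compact error is at
  most 1/2, so the left inverse modulo compact operators keeps \<open>f\<close> at distance at least
  \<open>d\<close> from its average. Some conjugate of \<open>f\<close> is then at least
  \<open>d\<close> away from \<open>f\<close>, and uniform convexity turns this into a deficit of
  the average.\<close>

lemma AO_property_spectral_gap:
  fixes F :: "'g::group_add set"
  assumes "AO_property TYPE('g)" and F: "finite F" "0 \<in> F" and "s < 1"
    and gap: "\<And>f. norm (\<Sum>g\<in>F. lambda_op (g, g) f) \<le> s * real (card F) * norm f"
  obtains E :: "'g set" and s' :: real where "finite E" "s' < 1"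
    "\<And>f. restr E f = 0 \<Longrightarrow> norm (\<Sum>g\<in>F. (lambda_op g o\<^sub>L rho_op g) f) \<le> s' * real (card F) * norm f"
proof -
  define c where "c = real (card F)"
  have c: "0 < c" using F by (auto simp: c_def card_gt_0_iff)
  define a where "a = (\<Sum>g\<in>F. Poly_Mapping.single (g, g) (complex_of_real (1 / c)))"
  have real: "cscale_ell2 (complex_of_real r) f = r *\<^sub>R f" for r and f :: "'b ell2"
    by (rule ell2_eqI) (simp add: scaleR_conv_of_real)
  \<comment> \<open>\<open>s\<close> may be negative, whereas a bound for an operator norm is
    nonnegative.\<close>
  have "norm (regular_rep a) \<le> max s 0"
  proof (rule norm_blinfun_bound)
    fix f :: "('g \<times> 'g) ell2"
    have "regular_rep a f = (1 / c) *\<^sub>R (\<Sum>g\<in>F. lambda_op (g, g) f)"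
      by (simp add: regular_rep_eq a_def rep_of_sum real blinfun.sum_left scaleR_sum_right
          del: of_real_divide)
    then have "norm (regular_rep a f) \<le> s * norm f"
      using gap[of f] c by (simp add: c_def field_simps)
    also have "\<dots> \<le> max s 0 * norm f" by (intro mult_right_mono) auto
    finally show "norm (regular_rep a f) \<le> max s 0 * norm f" .
  qed simp
  moreover have "max s 0 < 1" using \<open>s < 1\<close> by simp
  ultimately obtain S K where K: "K \<in> compact_ops" and S: "S o\<^sub>L left_right_rep (1 - a) = K + id_blinfun"
    using AO_property_parametrix[OF assms(1)] by (metis order_le_less_trans)
  obtain E where E: "finite E" "\<And>f. restr E f = 0 \<Longrightarrow> norm (blinfun_apply K f) \<le> norm f / 2"
    using compact_op_small_off_finite[OF K] by blast
  let ?C = "\<lambda>g. lambda_op g o\<^sub>L rho_op g"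
  have T: "left_right_rep (1 - a) f = (1 / c) *\<^sub>R (\<Sum>g\<in>F. f - ?C g f)" for f
  proof -
    have "left_right_rep (1 - a) f = f - (1 / c) *\<^sub>R (\<Sum>g\<in>F. ?C g f)"
      unfolding left_right_rep_eq rep_of_diff left_right.rep_of_one
      by (simp add: a_def rep_of_sum real blinfun.diff_left blinfun.sum_left scaleR_sum_right
          del: of_real_divide)
    then show ?thesis
      using c F by (auto simp: sum_subtractf scaleR_diff_right sum_constant_scaleR c_def
          del: blinfun_apply_blinfun_compose)
  qed
  \<comment> \<open>Off \<open>E\<close> the parametrix gives
    \<open>1 / 2 \<le> norm S * norm (left_right_rep (1 - a) f)\<close> for unit \<open>f\<close>;
    the added 1 keeps the denominator positive.\<close>
  define d where "d = 1 / (2 * (norm S + 1))"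
  have d: "0 < d" by (simp add: d_def add_nonneg_pos)
  \<comment> \<open>Makes \<open>4 * (c - s' * c)\<close> the square of \<open>d\<close>, to match
    \<open>unit_vectors_close\<close>.\<close>
  define s' where "s' = 1 - d\<^sup>2 / (4 * c)"
  have unit: "norm (\<Sum>g\<in>F. ?C g f) \<le> s' * c" if f: "restr E f = 0" "norm f = 1" for f
  proof -
    have "f = S (left_right_rep (1 - a) f) - K f"
      using arg_cong[OF S, of "\<lambda>T. blinfun_apply T f"] by (simp add: blinfun.add_left)
    then have "1 \<le> norm (S (left_right_rep (1 - a) f)) + norm (K f)"
      using f(2) by (metis norm_triangle_ineq4)
    also have "\<dots> \<le> norm S * norm (left_right_rep (1 - a) f) + 1 / 2"
      using E(2)[OF f(1)] f(2) norm_blinfun by (intro add_mono) auto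
    finally have "1 \<le> 2 * (norm S * norm (left_right_rep (1 - a) f))" by simp
    also have "\<dots> \<le> 2 * ((norm S + 1) * norm (left_right_rep (1 - a) f))"
      by (simp add: distrib_right)
    finally have "d \<le> norm (left_right_rep (1 - a) f)"
      unfolding d_def by (subst pos_divide_le_eq) (auto simp: add_pos_nonneg algebra_simps)
    then have ge: "d * c \<le> norm (\<Sum>g\<in>F. f - ?C g f)"
      unfolding T using c by (simp add: field_simps)
    have "\<exists>g\<in>F. d \<le> norm (f - ?C g f)"
    proof (rule ccontr)
      assume "\<not> ?thesis"
      then have "norm (f - ?C g f) < d" if "g \<in> F" for g
        using that by (meson not_le)
      then have "(\<Sum>g\<in>F. norm (f - ?C g f)) < (\<Sum>g\<in>F. d)"
        using F by (intro sum_strict_mono) auto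
      then show False
        using ge norm_sum[of "\<lambda>g. f - ?C g f" F] by (simp add: c_def mult.commute)
    qed
    then obtain g where g: "g \<in> F" "d \<le> norm (f - ?C g f)" by blast
    have "norm (?C g f) = 1" for g
      using left_right.norm_U[of "(g, g)" f] f(2) by simp
    then have "(norm (?C 0 f - ?C g f))\<^sup>2 \<le> 4 * (c - norm (\<Sum>g\<in>F. ?C g f))"
      unfolding c_def by (intro unit_vectors_close F g)
    moreover have "?C 0 f = f" by (simp add: lambda_op_zero rho_op_zero del: lambda_op.rep_eq)
    moreover have "d\<^sup>2 \<le> (norm (f - ?C g f))\<^sup>2" using g d by (intro power_mono) auto
    ultimately have "d\<^sup>2 \<le> 4 * (c - norm (\<Sum>g\<in>F. ?C g f))" by simp
    moreover have "s' * c = c - d\<^sup>2 / 4"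
      using c by (simp add: s'_def field_simps)
    ultimately show ?thesis by simp
  qed
  show thesis
  proof (rule that[OF E(1)])
    show "s' < 1" using c d by (simp add: s'_def)
    fix f
    assume f: "restr E f = 0"
    show "norm (\<Sum>g\<in>F. ?C g f) \<le> s' * real (card F) * norm f"
    proof (cases "f = 0")
      case False
      have "restr E (inverse (norm f) *\<^sub>R f) = inverse (norm f) *\<^sub>R restr E f"
        by (rule ell2_eqI) auto
      moreover have "(\<Sum>g\<in>F. ?C g (inverse (norm f) *\<^sub>R f)) = inverse (norm f) *\<^sub>R (\<Sum>g\<in>F. ?C g f)"
        by (simp only: blinfun.scaleR_right scaleR_sum_right)
      ultimately show ?thesis
        using unit[of "inverse (norm f) *\<^sub>R f"] f False
        by (simp add: c_def field_simps del: blinfun_apply_blinfun_compose)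
    qed (simp add: blinfun.zero_right del: blinfun_apply_blinfun_compose)
  qed
qed

section \<open>A strictly superharmonic function\<close>

text \<open>\<open>W\<close> is the sum of \<open>(1 / q) ^ k\<close> times the \<open>k\<close>-th
  iterate of the compressed average on a positive vector. It converges since the compression has
  norm at most \<open>r < q\<close> on functions supported off \<open>E\<close>.\<close>

lemma spectral_gap_superharmonic:
  fixes F :: "'g::group_add set" and s :: real
  assumes count: "countable (UNIV :: 'g set)" and F: "finite F" "0 \<in> F" and "s < 1"
    and gap: "\<And>f. restr E f = 0 \<Longrightarrow> norm (\<Sum>g\<in>F. (lambda_op g o\<^sub>L rho_op g) f) \<le> s * real (card F) * norm f"
  obtains W :: "'g \<Rightarrow> real" and q where "0 < q" "q < 1" "\<And>x. x \<in> E \<Longrightarrow> W x = 0" "\<And>x. x \<notin> E \<Longrightarrow> 0 < W x"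
    "\<And>x. x \<notin> E \<Longrightarrow> (\<Sum>g\<in>F. W (- g + x + g)) \<le> q * real (card F) * W x"
proof -
  define n where "n = real (card F)"
  have n: "0 < n" using F by (auto simp: n_def card_gt_0_iff)
  define r where "r = max s (1 / 2)"
  define q where "q = (1 + r) / 2"
  have r: "0 < r" "r < q" "0 < q" "q < 1" using \<open>s < 1\<close> by (auto simp: r_def q_def)
  \<comment> \<open>The projection keeps all iterates supported off \<open>E\<close>, where the gap
    applies.\<close>
  define A where "A f = (1 / n) *\<^sub>R restr (- E) (\<Sum>g\<in>F. (lambda_op g o\<^sub>L rho_op g) f)" for f
  have A_apply: "Re (ell2_apply (A f) x)
      = (if x \<in> E then 0 else (1 / n) * (\<Sum>g\<in>F. Re (ell2_apply f (- g + x + g))))" for f x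
    by (simp add: A_def add.assoc)
  have A_E: "restr E (A f) = 0" for f
    by (rule ell2_eqI) (simp add: A_def)
  have norm_A: "norm (A f) \<le> r * norm f" if "restr E f = 0" for f
  proof -
    have "norm (restr (- E) (\<Sum>g\<in>F. (lambda_op g o\<^sub>L rho_op g) f)) \<le> s * n * norm f"
      using gap[OF that] norm_restr_le unfolding n_def by (rule order_trans[rotated])
    also have "\<dots> \<le> r * n * norm f"
      using n by (intro mult_right_mono) (auto simp: r_def)
    finally show ?thesis
      using n by (simp add: A_def field_simps del: blinfun_apply_blinfun_compose)
  qed
  \<comment> \<open>Countability enters here: weights along an enumeration are strictly positive,
    and their squares are part of a geometric series of ratio 1/4.\<close>
  define p where "p x = (1 / 2 :: real) ^ to_nat_on (UNIV :: 'g set) x" for x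
  have p: "0 < p x" for x by (simp add: p_def)
  have "(\<lambda>k. (1 / 4 :: real) ^ k) summable_on UNIV"
    by (rule norm_summable_imp_summable_on) (simp add: summable_geometric)
  then have "(\<lambda>k. (1 / 4 :: real) ^ k) summable_on range (to_nat_on (UNIV :: 'g set))"
    by (rule summable_on_subset_banach) simp
  then have "(\<lambda>x. (1 / 4 :: real) ^ to_nat_on (UNIV :: 'g set) x) summable_on UNIV"
    by (subst (asm) summable_on_reindex) (simp_all add: inj_on_to_nat_on[OF count] comp_def)
  then have "(\<lambda>x. (cmod (complex_of_real (p x)))\<^sup>2) summable_on UNIV"
    by (simp add: p_def norm_power power2_eq_square flip: power_mult_distrib)
  then have \<psi>0: "ell2_apply (Abs_ell2 (\<lambda>x. complex_of_real (p x))) = (\<lambda>x. complex_of_real (p x))"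
    by (subst Abs_ell2_inverse) auto
  define \<psi> where "\<psi> = restr (- E) (Abs_ell2 (\<lambda>x. complex_of_real (p x)))"
  define v where "v k = (A ^^ k) \<psi>" for k
  have v_0: "v 0 = \<psi>" and v_Suc: "v (Suc k) = A (v k)" for k
    by (simp_all add: v_def)
  have v_E: "restr E (v k) = 0" for k
    by (cases k) (auto simp: v_0 v_Suc A_E \<psi>_def intro!: ell2_eqI)
  have norm_v: "norm (v k) \<le> r ^ k * norm \<psi>" for k
  proof (induction k)
    case (Suc k)
    have "norm (v (Suc k)) \<le> r * norm (v k)"
      unfolding v_Suc by (rule norm_A[OF v_E])
    also have "\<dots> \<le> r * (r ^ k * norm \<psi>)"
      using Suc r by (intro mult_left_mono) auto
    finally show ?case by (simp add: mult.assoc)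
  qed (simp add: v_0)
  have "summable (\<lambda>k. (r / q) ^ k * norm \<psi>)"
    using r by (intro summable_mult2 summable_geometric) simp
  then have summ: "summable (\<lambda>k. (1 / q) ^ k *\<^sub>R v k)"
  proof (rule summable_comparison_test[rotated], intro exI allI impI)
    fix k
    have "norm ((1 / q) ^ k *\<^sub>R v k) = (1 / q) ^ k * norm (v k)"
      using r by simp
    also have "\<dots> \<le> (1 / q) ^ k * (r ^ k * norm \<psi>)"
      using r by (intro mult_left_mono norm_v) simp
    finally show "norm ((1 / q) ^ k *\<^sub>R v k) \<le> (r / q) ^ k * norm \<psi>"
      by (simp add: power_divide)
  qed
  define W where "W x = Re (ell2_apply (suminf (\<lambda>k. (1 / q) ^ k *\<^sub>R v k)) x)" for x
  have W: "(\<lambda>k. (1 / q) ^ k * Re (ell2_apply (v k) x)) sums W x" for x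
    using bounded_linear.sums[OF bounded_linear_compose[OF bounded_linear_Re bounded_linear_ell2_apply]
        summable_sums[OF summ], of x]
    by (simp add: W_def)
  have v_nonneg: "0 \<le> Re (ell2_apply (v k) x)" for k x
  proof (induction k arbitrary: x)
    case 0
    show ?case by (simp add: v_0 \<psi>_def \<psi>0 less_imp_le[OF p])
  next
    case (Suc k)
    then show ?case using n by (auto simp: v_Suc A_apply intro!: divide_nonneg_nonneg sum_nonneg)
  qed
  have W_nonneg: "0 \<le> W x" for x
    by (rule sums_le[OF _ sums_zero W]) (use r v_nonneg in simp)
  \<comment> \<open>Pointwise form of \<open>W = \<psi> + (1 / q) A W\<close>: applying the average
    shifts the index of the series by one, and the term of index 0 is \<open>p x\<close>.\<close>
  have W_eq: "W x = p x + (1 / q) * ((1 / n) * (\<Sum>g\<in>F. W (- g + x + g)))" if x: "x \<notin> E" for x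
  proof -
    have "(\<lambda>k. (1 / q) * ((1 / n) * (\<Sum>g\<in>F. (1 / q) ^ k * Re (ell2_apply (v k) (- g + x + g)))))
        sums ((1 / q) * ((1 / n) * (\<Sum>g\<in>F. W (- g + x + g))))"
      by (intro sums_mult sums_sum W)
    moreover have "(1 / q) * ((1 / n) * (\<Sum>g\<in>F. (1 / q) ^ k * Re (ell2_apply (v k) (- g + x + g))))
        = (1 / q) ^ Suc k * Re (ell2_apply (v (Suc k)) x)" for k
      using x by (simp add: v_Suc A_apply flip: sum_distrib_left)
    ultimately have "(\<lambda>k. (1 / q) ^ Suc k * Re (ell2_apply (v (Suc k)) x))
        sums ((1 / q) * ((1 / n) * (\<Sum>g\<in>F. W (- g + x + g))))"
      by simp
    then have "(\<lambda>k. (1 / q) ^ k * Re (ell2_apply (v k) x))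
        sums ((1 / q) * ((1 / n) * (\<Sum>g\<in>F. W (- g + x + g))) + (1 / q) ^ 0 * Re (ell2_apply (v 0) x))"
      using sums_Suc_iff[of "\<lambda>k. (1 / q) ^ k * Re (ell2_apply (v k) x)"] by blast
    then have "W x = (1 / q) * ((1 / n) * (\<Sum>g\<in>F. W (- g + x + g))) + (1 / q) ^ 0 * Re (ell2_apply (v 0) x)"
      by (rule sums_unique2[OF W])
    then show ?thesis
      using x by (simp add: v_0 \<psi>_def \<psi>0)
  qed
  show thesis
  proof
    show "0 < q" "q < 1" by fact+
    show "W x = 0" if "x \<in> E" for x
    proof -
      have "Re (ell2_apply (v k) x) = 0" for k
        using that arg_cong[OF v_E[of k], of "\<lambda>f. ell2_apply f x"] by simp
      then show ?thesis
        using W[of x] sums_unique2[OF _ sums_zero] by simp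
    qed
    fix x
    assume x: "x \<notin> E"
    have "0 \<le> (1 / q) * ((1 / n) * (\<Sum>g\<in>F. W (- g + x + g)))"
      using r n by (intro mult_nonneg_nonneg sum_nonneg W_nonneg) auto
    then show "0 < W x"
      using W_eq[OF x] p[of x] by linarith
    have "(1 / q) * ((1 / n) * (\<Sum>g\<in>F. W (- g + x + g))) \<le> W x"
      using W_eq[OF x] p[of x] by linarith
    then show "(\<Sum>g\<in>F. W (- g + x + g)) \<le> q * real (card F) * W x"
      using r n by (simp add: n_def field_simps)
  qed
qed

section \<open>Integrating ultrafilter limits\<close>

text \<open>Compactness of the interval gives a cluster point, and an ultrafilter converges to its
  cluster points. Thus \<open>Lim F f\<close>, as a function of \<open>F\<close>, is the extension
  of a bounded \<open>f\<close> to the compactification.\<close>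

lemma stone_cech_tendsto_Lim:
  fixes f :: "'a \<Rightarrow> real"
  assumes F: "F \<in> stone_cech" and f: "\<And>x. f x \<in> {a..b}"
  shows "(f \<longlongrightarrow> Lim F f) F"
proof -
  have ne: "F \<noteq> bot" and ultra: "\<And>A. eventually (\<lambda>x. x \<in> A) F \<or> eventually (\<lambda>x. x \<notin> A) F"
    using F by (auto simp: stone_cech_def)
  have "eventually (\<lambda>y. y \<in> {a..b}) (filtermap f F)"
    unfolding eventually_filtermap using f by (intro always_eventually) blast
  moreover have "filtermap f F \<noteq> bot"
    using ne by (simp add: filtermap_bot_iff)
  ultimately obtain l where l: "inf (nhds l) (filtermap f F) \<noteq> bot"
    using compact_Icc[of a b] unfolding compact_filter by blast
  have "(f \<longlongrightarrow> l) F"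
  proof (rule topological_tendstoI, rule ccontr)
    fix S
    assume S: "open S" "l \<in> S" and "\<not> eventually (\<lambda>x. f x \<in> S) F"
    then have "eventually (\<lambda>y. y \<notin> S) (filtermap f F)"
      using ultra[of "f -` S"] by (auto simp: eventually_filtermap)
    then have "eventually (\<lambda>y. False) (inf (nhds l) (filtermap f F))"
      unfolding eventually_inf using eventually_nhds_in_open[OF S] by blast
    with l show False by (simp add: eventually_False)
  qed
  then show ?thesis
    using tendsto_Lim[OF ne, of f l] by simp
qed

lemma topspace_stone_cech: "topspace (stone_cech_topology :: 'a filter topology) = stone_cech"
  by (auto simp: stone_cech_topology_def intro!: exI[of _ UNIV])

lemma space_borel_sigma: "space (borel_sigma X) = topspace X"
  by (simp add: borel_sigma_def space_measure_of_conv)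

lemma sets_borel_sigma: "sets (borel_sigma X) = sigma_sets (topspace X) {U. openin X U}"
  unfolding borel_sigma_def by (rule sets_measure_of) (auto dest: openin_subset)

section \<open>Measures invariant under conjugation\<close>

locale inner_mean = prob_space M for M :: "'g::group_add filter measure" +
  assumes sets_M: "sets M
      = sets (borel_sigma (subtopology stone_cech_topology (stone_cech - {principal {0}})))"
    and invariant: "distr M M (filtermap (\<lambda>x. g + x - g)) = M"
    and icc: "icc TYPE('g)"
begin

lemma space_M: "space M = stone_cech - {principal {0}}"
  using sets_eq_imp_space_eq[OF sets_M]
  by (simp add: space_borel_sigma topspace_stone_cech Int_absorb1)

lemma sets_M_eq: "sets M
    = sigma_sets (space M) {U. openin (subtopology stone_cech_topology (space M)) U}"
  unfolding sets_M sets_borel_sigma topspace_subtopology topspace_stone_cech space_M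
  by (simp only: Int_absorb1 Diff_subset)

text \<open>The basic clopen sets: the closure of \<open>A\<close> in the compactification, without
  the point \<open>principal {0}\<close>.\<close>

definition cyl :: "'g set \<Rightarrow> 'g filter set" where
  "cyl A = {F \<in> space M. eventually (\<lambda>x. x \<in> A) F}"

lemma openin_cyl: "openin (subtopology stone_cech_topology (space M)) (cyl A)"
proof -
  have "openin stone_cech_topology {F \<in> stone_cech. eventually (\<lambda>x. x \<in> A) F}"
    unfolding stone_cech_topology_def by (rule topology_generated_by_Basis) simp
  then show ?thesis
    unfolding openin_subtopology cyl_def space_M by blast
qed

lemma sets_cyl [measurable]: "cyl A \<in> sets M"
  unfolding sets_M_eq by (rule sigma_sets.Basic) (simp add: openin_cyl)

text \<open>Conjugation by \<open>- g\<close> undoes conjugation by \<open>g\<close> and fixes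
  \<open>principal {0}\<close>, so no other point can be mapped there.\<close>

lemma filtermap_conj_space:
  assumes "F \<in> space M"
  shows "filtermap (\<lambda>x. g + x - g) F \<in> space M"
proof -
  have "filtermap (\<lambda>x. g + x - g) F \<in> stone_cech"
  proof -
    have "eventually (\<lambda>x. g + x - g \<in> A) F \<or> eventually (\<lambda>x. g + x - g \<notin> A) F" for A
    proof -
      have "eventually (\<lambda>x. x \<in> {x. g + x - g \<in> A}) F \<or> eventually (\<lambda>x. x \<notin> {x. g + x - g \<in> A}) F"
        using assms unfolding space_M stone_cech_def by blast
      then show ?thesis by simp
    qed
    then show ?thesis
      using assms by (auto simp: space_M stone_cech_def filtermap_bot_iff eventually_filtermap)
  qed
  moreover have "filtermap (\<lambda>x. g + x - g) F \<noteq> principal {0}"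
  proof
    assume eq: "filtermap (\<lambda>x. g + x - g) F = principal {0}"
    have "- g + (g + x - g) + g = x" for x
      by (simp add: diff_conv_add_uminus add.assoc del: add_uminus_conv_diff)
    then have "F = filtermap (\<lambda>x. - g + x + g) (filtermap (\<lambda>x. g + x - g) F)"
      by (simp only: filtermap_filtermap filtermap_ident)
    also have "\<dots> = principal {0}"
      unfolding eq by (simp add: filtermap_principal)
    finally show False using assms by (simp add: space_M)
  qed
  ultimately show ?thesis by (simp add: space_M)
qed

text \<open>The preimage of a basic open set is again basic, so the map is continuous. Measurability
  is what lets \<open>distr\<close> be evaluated as an image measure.\<close>

lemma measurable_filtermap_conj [measurable]: "filtermap (\<lambda>x. g + x - g) \<in> measurable M M"
proof (rule measurable_sigma_sets[OF sets_M_eq])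
  let ?c = "filtermap (\<lambda>x. g + x - g)" and ?X = "subtopology stone_cech_topology (space M)"
  have top: "topspace ?X = space M"
    unfolding topspace_subtopology topspace_stone_cech space_M by blast
  show "{U. openin ?X U} \<subseteq> Pow (space M)"
    using openin_subset[of ?X] top by auto
  show "?c \<in> space M \<rightarrow> space M"
    using filtermap_conj_space by blast
  let ?B = "range (\<lambda>A. {F \<in> stone_cech :: 'g filter set. eventually (\<lambda>x. x \<in> A) F})"
  have "continuous_map ?X (topology_generated_by ?B) ?c"
  proof (rule continuous_on_generated_topo)
    fix U
    assume "U \<in> ?B"
    then obtain A where U: "U = {F \<in> stone_cech. eventually (\<lambda>x. x \<in> A) F}" by blast
    have "?c -` U \<inter> space M = cyl ((\<lambda>x. g + x - g) -` A)"
      using filtermap_conj_space unfolding U cyl_def space_M by (auto simp: eventually_filtermap)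
    then show "openin ?X (?c -` U \<inter> topspace ?X)"
      unfolding top using openin_cyl by simp
  next
    show "?c ` topspace ?X \<subseteq> \<Union> ?B"
    proof -
      have "\<Union> ?B = stone_cech"
        using topspace_stone_cech unfolding stone_cech_topology_def topology_generated_by_topspace .
      moreover have "?c ` topspace ?X \<subseteq> space M"
        unfolding top by (intro image_subsetI filtermap_conj_space)
      ultimately show ?thesis
        unfolding space_M by blast
    qed
  qed
  then have "continuous_map ?X stone_cech_topology ?c"
    unfolding stone_cech_topology_def[symmetric] .
  then have "continuous_map ?X ?X ?c"
    using filtermap_conj_space top by (simp add: continuous_map_in_subtopology)
  then have "openin ?X {F \<in> space M. ?c F \<in> U}" if "openin ?X U" for U
    using openin_continuous_map_preimage[of ?X ?X ?c U] that unfolding top by blast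
  moreover have "?c -` U \<inter> space M = {F \<in> space M. ?c F \<in> U}" for U by blast
  ultimately show "?c -` U \<inter> space M \<in> sets M" if "U \<in> {U. openin ?X U}" for U
    using that unfolding sets_M_eq by (intro sigma_sets.Basic) simp
qed

text \<open>Conjugate points have equal measure by invariance. A point other than \<open>0\<close>
  has infinitely many conjugates by ICC, and their cylinders are disjoint, so in a probability space
  each has measure zero. The point \<open>0\<close> was removed from the space.\<close>

lemma AE_neq: "AE F in M. eventually (\<lambda>x. x \<noteq> y) F"
proof -
  have shift: "measure M (cyl {g + y - g}) = measure M (cyl {y})" for g y
  proof -
    have conj_eq: "g + x - g = g + y - g \<longleftrightarrow> x = y" for x
      by (metis add_left_cancel diff_add_cancel)
    have "measure M (cyl {g + y - g})
        = measure (distr M M (filtermap (\<lambda>x. g + x - g))) (cyl {g + y - g})"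
      by (simp add: invariant)
    also have "\<dots> = measure M (filtermap (\<lambda>x. g + x - g) -` cyl {g + y - g} \<inter> space M)"
      by (rule measure_distr) measurable
    also have "filtermap (\<lambda>x. g + x - g) -` cyl {g + y - g} \<inter> space M = cyl {y}"
      using filtermap_conj_space by (auto simp: cyl_def eventually_filtermap conj_eq)
    finally show ?thesis .
  qed
  have "measure M (cyl {y}) = 0"
  proof (cases "y = 0")
    case True
    have "F = principal {0}" if "F \<noteq> bot" "eventually (\<lambda>x. x = 0) F" for F :: "'g filter"
    proof (rule antisym)
      show "F \<le> principal {0}"
        using that(2) by (simp add: le_principal)
      show "principal {0} \<le> F"
      proof (rule filter_leI)
        fix P
        assume "eventually P F"
        with that(2) have "eventually (\<lambda>x. P 0) F"
          by eventually_elim simp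
        then show "eventually P (principal {0})"
          using that(1) by (simp add: eventually_principal)
      qed
    qed
    then have "cyl {y} = {}"
      using True by (auto simp: cyl_def space_M stone_cech_def)
    then show ?thesis by simp
  next
    case False
    then have inf: "infinite (range (\<lambda>g. g + y - g))"
      using icc by (simp add: icc_def)
    show ?thesis
    proof (rule ccontr)
      assume "measure M (cyl {y}) \<noteq> 0"
      then have pos: "0 < measure M (cyl {y})"
        using zero_less_measure_iff by blast
      then obtain N where N: "1 < real N * measure M (cyl {y})"
        using reals_Archimedean3 by blast
      obtain Y where Y: "finite Y" "card Y = N" "Y \<subseteq> range (\<lambda>g. g + y - g)"
        using infinite_arbitrarily_large[OF inf] by blast
      have "disjoint_family_on (\<lambda>z. cyl {z}) Y"
      proof (unfold disjoint_family_on_def, intro ballI impI)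
        fix z z' :: 'g
        assume "z \<noteq> z'"
        show "cyl {z} \<inter> cyl {z'} = {}"
        proof (rule equals0I)
          fix F
          assume "F \<in> cyl {z} \<inter> cyl {z'}"
          then have ev: "eventually (\<lambda>x. x = z) F" "eventually (\<lambda>x. x = z') F" and "F \<noteq> bot"
            by (auto simp: cyl_def space_M stone_cech_def)
          from ev have "eventually (\<lambda>x. False) F"
            by eventually_elim (use \<open>z \<noteq> z'\<close> in simp)
          with \<open>F \<noteq> bot\<close> show False by (simp add: eventually_False)
        qed
      qed
      then have "measure M (\<Union>z\<in>Y. cyl {z}) = (\<Sum>z\<in>Y. measure M (cyl {z}))"
        using Y by (intro finite_measure_finite_Union) auto
      also have "\<dots> = (\<Sum>z\<in>Y. measure M (cyl {y}))"
        using Y(3) shift by (intro sum.cong) auto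
      also have "\<dots> = real N * measure M (cyl {y})"
        using Y by simp
      finally show False
        using N prob_le_1[of "\<Union>z\<in>Y. cyl {z}"] by simp
    qed
  qed
  then have "cyl {y} \<in> null_sets M"
    by (simp add: null_sets_def emeasure_eq_measure)
  then show ?thesis
  proof (rule AE_I')
    have "eventually (\<lambda>x. x = y) F" if "F \<in> space M" "\<not> eventually (\<lambda>x. x \<noteq> y) F" for F
    proof -
      have "eventually (\<lambda>x. x \<in> {y}) F \<or> eventually (\<lambda>x. x \<notin> {y}) F"
        using that(1) unfolding space_M stone_cech_def by blast
      with that(2) show ?thesis by simp
    qed
    then show "{F \<in> space M. \<not> eventually (\<lambda>x. x \<noteq> y) F} \<subseteq> cyl {y}"
      by (auto simp: cyl_def)
  qed
qed

lemma AE_eventually_notin: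
  assumes "finite E"
  shows "AE F in M. eventually (\<lambda>x. x \<notin> E) F"
proof -
  have "AE F in M. \<forall>y\<in>E. eventually (\<lambda>x. x \<noteq> y) F"
    using assms AE_neq by (intro AE_finite_allI)
  then show ?thesis
  proof eventually_elim
    case (elim F)
    from eventually_ball_finite[OF assms elim] show ?case
      by eventually_elim auto
  qed
qed

lemma tendsto_Lim_space:
  fixes f :: "'g \<Rightarrow> real"
  assumes "F \<in> space M" "\<And>x. f x \<in> {a..b}"
  shows "(f \<longlongrightarrow> Lim F f) F"
  using stone_cech_tendsto_Lim assms by (auto simp: space_M)

lemma space_ne_bot: "F \<in> space M \<Longrightarrow> F \<noteq> bot"
  by (auto simp: space_M stone_cech_def)

text \<open>Sublevel sets of the limit are countable unions of cylinders. The margin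
  \<open>1 / real (Suc n)\<close> matters, since values below \<open>y\<close> may have limit
  \<open>y\<close>.\<close>

lemma measurable_Lim:
  fixes f :: "'g \<Rightarrow> real"
  assumes f: "\<And>x. f x \<in> {a..b}"
  shows "(\<lambda>F. Lim F f) \<in> borel_measurable M"
proof (rule borel_measurableI_less)
  fix y
  have "Lim F f < y \<longleftrightarrow> (\<exists>n. eventually (\<lambda>x. f x \<le> y - 1 / real (Suc n)) F)" if F: "F \<in> space M" for F
  proof
    assume "Lim F f < y"
    then obtain n where "1 / real (Suc n) < y - Lim F f"
      using reals_Archimedean[of "y - Lim F f"] by (auto simp: inverse_eq_divide)
    then have "eventually (\<lambda>x. f x < y - 1 / real (Suc n)) F"
      by (intro order_tendstoD(2)[OF tendsto_Lim_space[OF F f]]) simp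
    then show "\<exists>n. eventually (\<lambda>x. f x \<le> y - 1 / real (Suc n)) F"
      by (intro exI[of _ n]) (auto elim: eventually_mono)
  next
    assume "\<exists>n. eventually (\<lambda>x. f x \<le> y - 1 / real (Suc n)) F"
    then obtain n where "eventually (\<lambda>x. f x \<le> y - 1 / real (Suc n)) F" ..
    then have "Lim F f \<le> y - 1 / real (Suc n)"
      by (intro tendsto_upperbound[OF tendsto_Lim_space[OF F f]] space_ne_bot[OF F])
    also have "\<dots> < y" by simp
    finally show "Lim F f < y" .
  qed
  then have "{F \<in> space M. Lim F f < y} = (\<Union>n. cyl {x. f x \<le> y - 1 / real (Suc n)})"
    by (auto simp: cyl_def)
  then show "{F \<in> space M. Lim F f < y} \<in> sets M" by simp
qed

lemma integrable_Lim:
  fixes f :: "'g \<Rightarrow> real"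
  assumes f: "\<And>x. f x \<in> {a..b}"
  shows "integrable M (\<lambda>F. Lim F f)"
proof (rule integrable_const_bound[of _ "max \<bar>a\<bar> \<bar>b\<bar>"])
  show "AE F in M. norm (Lim F f) \<le> max \<bar>a\<bar> \<bar>b\<bar>"
  proof (rule AE_I2)
    fix F
    assume F: "F \<in> space M"
    have "a \<le> Lim F f" "Lim F f \<le> b"
      using f by (auto intro!: tendsto_upperbound[OF tendsto_Lim_space[OF F f]]
          tendsto_lowerbound[OF tendsto_Lim_space[OF F f]] space_ne_bot[OF F])
    then show "norm (Lim F f) \<le> max \<bar>a\<bar> \<bar>b\<bar>" by auto
  qed
qed (rule measurable_Lim[OF f])

lemma no_superharmonic:
  fixes W :: "'g \<Rightarrow> real"
  assumes F: "finite F" "0 \<in> F" "uminus ` F = F" and E: "finite E" and q: "0 < q" "q < 1"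
    and W_E: "\<And>x. x \<in> E \<Longrightarrow> W x = 0" and W_pos: "\<And>x. x \<notin> E \<Longrightarrow> 0 < W x"
    and super: "\<And>x. x \<notin> E \<Longrightarrow> (\<Sum>g\<in>F. W (- g + x + g)) \<le> q * real (card F) * W x"
  shows False
proof -
  define n where "n = real (card F)"
  have n: "0 < n" using F by (auto simp: n_def card_gt_0_iff)
  \<comment> \<open>On \<open>E\<close> the denominator is zero, so \<open>r g x = 0\<close> there
    by the convention for division, and the bounds below hold at every \<open>x\<close>.\<close>
  define r where "r g x = W (- g + x + g) / W x" for g x
  have W_nonneg: "0 \<le> W x" for x
    using W_E[of x] W_pos[of x] by (cases "x \<in> E") auto
  have sum_r: "(\<Sum>g\<in>F. r g x) \<le> q * n" for x
  proof (cases "x \<in> E")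
    case True
    then show ?thesis using q n by (simp add: r_def W_E)
  next
    case False
    then show ?thesis
      using super[OF False] W_pos[OF False] by (simp add: r_def n_def divide_le_eq flip: sum_divide_distrib)
  qed
  have r_nonneg: "0 \<le> r g x" for g x
    by (simp add: r_def W_nonneg)
  \<comment> \<open>A nonnegative term is at most the whole sum; this boundedness provides the
    limits along ultrafilters and their integrability.\<close>
  have r: "r g x \<in> {0..q * n}" if "g \<in> F" for g x
    using member_le_sum[of g F "\<lambda>g. r g x"] that F r_nonneg sum_r[of x] by fastforce
  define J where "J g = (\<integral>F. Lim F (r g) \<partial>M)" for g
  have "(\<Sum>g\<in>F. J g) = (\<integral>G. (\<Sum>g\<in>F. Lim G (r g)) \<partial>M)"
    unfolding J_def using integrable_Lim[OF r] by (subst Bochner_Integration.integral_sum) auto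
  also have "\<dots> \<le> (\<integral>G. q * n \<partial>M)"
  proof (rule integral_mono)
    show "integrable M (\<lambda>G. \<Sum>g\<in>F. Lim G (r g))"
      using integrable_Lim[OF r] by (intro Bochner_Integration.integrable_sum) auto
    fix G
    assume G: "G \<in> space M"
    have "((\<lambda>x. \<Sum>g\<in>F. r g x) \<longlongrightarrow> (\<Sum>g\<in>F. Lim G (r g))) G"
      by (intro tendsto_sum tendsto_Lim_space[OF G r])
    then show "(\<Sum>g\<in>F. Lim G (r g)) \<le> q * n"
      by (rule tendsto_upperbound) (use sum_r space_ne_bot[OF G] in auto)
  qed simp
  also have "\<dots> = q * n" by (simp add: prob_space)
  finally have upper: "(\<Sum>g\<in>F. J g) \<le> q * n" .
  have pair: "2 \<le> J g + J (- g)" if g: "g \<in> F" for g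
  proof -
    let ?h = "\<lambda>x. - g + x - - g"
    have g': "- g \<in> F" using F(3) g by blast
    \<comment> \<open>Invariance under conjugation by \<open>- g\<close> evaluates
      \<open>r (- g)\<close> at \<open>- g + x + g\<close>, where it is the reciprocal of
      \<open>r g x\<close> as long as \<open>W\<close> does not vanish.\<close>
    have "J (- g) = (\<integral>G. Lim G (r (- g)) \<partial>distr M M (filtermap ?h))"
      by (simp only: J_def invariant)
    also have "\<dots> = (\<integral>G. Lim (filtermap ?h G) (r (- g)) \<partial>M)"
      by (rule integral_distr[OF measurable_filtermap_conj measurable_Lim[OF r[OF g']]])
    finally have J': "J (- g) = (\<integral>G. Lim (filtermap ?h G) (r (- g)) \<partial>M)" .
    have int': "integrable M (\<lambda>G. Lim (filtermap ?h G) (r (- g)))"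
      using integrable_Lim[OF r[OF g']]
        integrable_distr_eq[OF measurable_filtermap_conj measurable_Lim[OF r[OF g']], of "- g"]
      by (simp only: invariant)
    have "J g + J (- g) = (\<integral>G. Lim G (r g) + Lim (filtermap ?h G) (r (- g)) \<partial>M)"
      unfolding J' unfolding J_def
      by (rule Bochner_Integration.integral_add[symmetric, OF integrable_Lim[OF r[OF g]] int'])
    also have "\<dots> \<ge> (\<integral>G. 2 \<partial>M)"
    proof (rule integral_mono_AE)
      show "integrable M (\<lambda>G. Lim G (r g) + Lim (filtermap ?h G) (r (- g)))"
        by (intro Bochner_Integration.integrable_add integrable_Lim[OF r[OF g]] int')
      \<comment> \<open>Off this set both \<open>x\<close> and \<open>- g + x + g\<close> avoid
        \<open>E\<close>.\<close>
      have "finite (E \<union> (\<lambda>e. g + e - g) ` E)" using E by simp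
      from AE_eventually_notin[OF this] AE_space
      show "AE G in M. 2 \<le> Lim G (r g) + Lim (filtermap ?h G) (r (- g))"
      proof eventually_elim
        case (elim G)
        note G = elim(2)
        have "(r (- g) \<longlongrightarrow> Lim (filtermap ?h G) (r (- g))) (filtermap ?h G)"
          by (rule tendsto_Lim_space[OF filtermap_conj_space[OF G] r[OF g']])
        then have "((\<lambda>x. r (- g) (?h x)) \<longlongrightarrow> Lim (filtermap ?h G) (r (- g))) G"
          by (simp add: filterlim_filtermap)
        then have lim: "((\<lambda>x. r g x + r (- g) (?h x))
            \<longlongrightarrow> Lim G (r g) + Lim (filtermap ?h G) (r (- g))) G"
          by (intro tendsto_add tendsto_Lim_space[OF G r[OF g]])
        from elim(1) have "eventually (\<lambda>x. 2 \<le> r g x + r (- g) (?h x)) G"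
        proof eventually_elim
          case (elim x)
          define y where "y = - g + x + g"
          have x: "x = g + y - g" by (simp add: y_def flip: add.assoc)
          have pos: "0 < W x" "0 < W y"
            using elim W_pos x by auto
          have "r g x + r (- g) (?h x) = W y / W x + W x / W y"
            by (simp add: r_def y_def flip: add.assoc)
          moreover have "2 \<le> W y / W x + W x / W y"
          proof -
            have "2 * (W x * W y) \<le> W y * W y + W x * W x"
              using sum_squares_bound[of "W x" "W y"] by (simp add: power2_eq_square)
            then show ?thesis
              using pos by (simp add: field_simps)
          qed
          ultimately show ?case by simp
        qed
        then show ?case
          by (rule tendsto_lowerbound[OF lim]) (rule space_ne_bot[OF G])
      qed
    qed simp
    finally show ?thesis by (simp add: prob_space)
  qed
  \<comment> \<open>By the symmetry of \<open>F\<close>, the sum over pairs counts every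
    \<open>J g\<close> twice, so the sum of the \<open>J g\<close> is at least \<open>n\<close>,
    against the upper bound \<open>q * n\<close>.\<close>
  have "(\<Sum>g\<in>F. J (- g)) = (\<Sum>g\<in>uminus ` F. J g)"
    by (subst sum.reindex) (auto simp: inj_on_def)
  then have "(\<Sum>g\<in>F. J g + J (- g)) = 2 * (\<Sum>g\<in>F. J g)"
    by (simp add: sum.distrib F(3))
  moreover have "2 * n \<le> (\<Sum>g\<in>F. J g + J (- g))"
    using sum_mono[of F "\<lambda>_. 2" "\<lambda>g. J g + J (- g)"] pair by (simp add: n_def mult.commute)
  ultimately have "n \<le> q * n" using upper by linarith
  then show False using q n by simp
qed

end

theorem corollary2p2:
  assumes "countable (UNIV :: 'g::group_add set)"
    and "icc TYPE('g)"
    and "inner_amenable TYPE('g)"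
    and "\<not> amenable TYPE('g)"
  shows "\<not> AO_property TYPE('g)"
proof
  assume AO: "AO_property TYPE('g)"
  obtain F :: "'g set" and s where F: "finite F" "0 \<in> F" "uminus ` F = F" and s: "s < 1"
    and gap: "\<And>f. norm (\<Sum>g\<in>F. lambda_op (g, g) f) \<le> s * real (card F) * norm f"
    using nonamenable_spectral_gap[OF assms(1,4)] by blast
  obtain E s' where E: "finite E" and s': "s' < 1"
    and off: "\<And>f. restr E f = 0 \<Longrightarrow>
      norm (\<Sum>g\<in>F. (lambda_op g o\<^sub>L rho_op g) f) \<le> s' * real (card F) * norm f"
    using AO_property_spectral_gap[OF AO F(1,2) s gap] by blast
  obtain M :: "'g filter measure" where "prob_space M"
    "sets M = sets (borel_sigma (subtopology stone_cech_topology (stone_cech - {principal {0}})))"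
    "\<And>g. distr M M (filtermap (\<lambda>x. g + x - g)) = M"
    using assms(3) unfolding inner_amenable_def by blast
  then interpret inner_mean M
    using assms(2) by (simp add: inner_mean_def inner_mean_axioms_def)
  show False
  proof (rule spectral_gap_superharmonic[where E = E, OF assms(1) F(1,2) s' off])
    fix W :: "'g \<Rightarrow> real" and q
    assume W: "0 < q" "q < 1" "\<And>x. x \<in> E \<Longrightarrow> W x = 0" "\<And>x. x \<notin> E \<Longrightarrow> 0 < W x"
      "\<And>x. x \<notin> E \<Longrightarrow> (\<Sum>g\<in>F. W (- g + x + g)) \<le> q * real (card F) * W x"
    show False
      by (rule no_superharmonic[OF F E W])
  qed
qed

end
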